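(* Let $p$ be a prime, $l$ and $n$ positive integers, $h\in\mathbb{Z}$, $\xi\in T_p$, and $q\in\mathbb{C}_p$ with $|q-1|_p<p^{-1/(p-1)}$. For every positive integer $N$ and every integer $0\le a<lp^N$ define $$\mu^{(h)}_{n,\xi}(a+lp^N\mathbb{Z}_p)=[lp^N;q]^{\,n-1}q^{ha}\xi^{a}\,\beta^{(h)}_{n,\xi^{lp^N}}\!\left(\frac{a}{lp^N},\,q^{lp^N}\right).$$ Then $\mu^{(h)}_{n,\xi}$ extends uniquely to a distribution on $X$, i.e. to a finitely additive $\mathbb{C}_p$-valued function on the compact open subsets of $X$.
   Context: $\mathbb{C}_p$ is the completion of an algebraic closure of $\mathbb{Q}_p$. For $z\in\mathbb{Z}_p$, $q^z=\exp(z\log q)$ and $[z;q]=\frac{1-q^z}{1-q}$. $T_p$ is the set of $p$-power roots of unity in $\mathbb{C}_p$. $X=\varprojlim_N\mathbb{Z}/lp^N\mathbb{Z}$ and, for an integer $a$, $a+lp^N\mathbb{Z}_p=\{x\in X: x\equiv a \pmod{lp^N}\}$. For $Q\in\mathbb{C}_p$ with $|Q-1|_p<p^{-1/(p-1)}$ and $f$ uniformly differentiable on $\mathbb{Z}_p$, $\int_{\mathbb{Z}_p}f(y)\,d\mu_Q(y)=\lim_{M\to\infty}\frac{1}{[p^M;Q]}\sum_{y=0}^{p^M-1}f(y)Q^{y}$. For a positive integer $m$, an integer $a$ and $\zeta\in T_p$, the twisted $q$-Bernoulli value $\beta^{(h)}_{n,\zeta}\!\left(\frac{a}{m},q^{m}\right)$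 is defined as $\int_{\mathbb{Z}_p}q^{m(h-1)y}\zeta^{y}\left(\frac{1-q^{a+my}}{1-q^{m}}\right)^{n}d\mu_{q^{m}}(y)$ (this is $\int_{\mathbb{Z}_p}Q^{(h-1)y}\zeta^y[\frac am+y;Q]^n d\mu_Q(y)$ with $Q=q^m$). *)

theory Defs
  imports "HOL-Analysis.Analysis" "HOL-Number_Theory.Cong"
begin

section \<open>The field of p-adic complex numbers\<close>

text \<open>The library constrains \<open>norm\<close> to real vector spaces, hence a separate absolute value.
  Its definiteness is inherited from the metric.\<close>

class complete_nonarch_field = field_char_0 + complete_space +
  fixes absv :: "'a \<Rightarrow> real"
  assumes dist_absv: "dist x y = absv (x - y)"
    and absv_mult: "absv (x * y) = absv x * absv y"
    and absv_add_le: "absv (x + y) \<le> max (absv x) (absv y)"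

definition algebraic_over :: "'a::field set \<Rightarrow> 'a \<Rightarrow> bool" where
  "algebraic_over F x \<longleftrightarrow> (\<exists>f. f \<noteq> 0 \<and> (\<forall>i. coeff f i \<in> F) \<and> poly f x = 0)"

text \<open>When \<open>absv p = 1/p\<close>, the ultrametric inequality forces the absolute value to be the p-adic
  one on the rationals, so in a complete field their closure is (a copy of) the field of p-adic
  numbers.\<close>

definition Qp :: "'a::complete_nonarch_field set" where
  "Qp = closure \<rat>"

definition Qp_alg :: "'a::complete_nonarch_field set" where
  "Qp_alg = {x. algebraic_over Qp x}"

text \<open>\<open>is_Cp p TYPE('a)\<close>: the complete field \<open>'a\<close> is a completion of an algebraic closure of the
  p-adic numbers, with the absolute value normalised by \<open>absv p = 1/p\<close>. The second clause says that
  \<open>Qp_alg\<close>, which is algebraic over \<open>Qp\<close> by definition, is algebraically closed, and the third that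
  it is dense.\<close>

definition is_Cp :: "nat \<Rightarrow> 'a::complete_nonarch_field itself \<Rightarrow> bool" where
  "is_Cp p _ \<longleftrightarrow>
     absv (of_nat p :: 'a) = 1 / real p \<and>
     (\<forall>f :: 'a poly. degree f > 0 \<and> (\<forall>i. coeff f i \<in> Qp_alg) \<longrightarrow> (\<exists>x\<in>Qp_alg. poly f x = 0)) \<and>
     closure (Qp_alg :: 'a set) = UNIV"

definition Tp :: "nat \<Rightarrow> 'a::field set" where
  "Tp p = {\<zeta>. \<exists>k. \<zeta> ^ (p ^ k) = 1}"


section \<open>Powers with p-adic integer exponents and q-numbers\<close>

definition padic_exp :: "'a::complete_nonarch_field \<Rightarrow> 'a" where
  "padic_exp x = (\<Sum>k. x ^ k / fact k)"

definition padic_log :: "'a::complete_nonarch_field \<Rightarrow> 'a" where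
  "padic_log x = (\<Sum>k. (-1) ^ k * (x - 1) ^ Suc k / of_nat (Suc k))"

definition qpow :: "'a::complete_nonarch_field \<Rightarrow> 'a \<Rightarrow> 'a" where
  "qpow q z = padic_exp (z * padic_log q)"

text \<open>The power \<open>\<zeta> ^ y\<close> of a root of unity of p-power order, for a p-adic integer \<open>y\<close>: the limit of
  \<open>\<zeta> ^ k\<close> as the natural number \<open>k\<close> tends p-adically to \<open>y\<close>. (It cannot be obtained from \<open>qpow\<close>,
  because the logarithm of \<open>\<zeta>\<close> is 0.)\<close>

definition rootpow :: "'a::complete_nonarch_field \<Rightarrow> 'a \<Rightarrow> 'a" where
  "rootpow \<zeta> y = Lim (filtercomap of_nat (nhds y)) (\<lambda>k. \<zeta> ^ k)"

text \<open>At \<open>q = 1\<close> the quotients \<open>(1 - q\<^sup>x) / (1 - q\<^sup>m)\<close> are read as their limits \<open>x / m\<close>.\<close>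

definition qnum :: "'a::complete_nonarch_field \<Rightarrow> 'a \<Rightarrow> 'a" where
  "qnum z q = (if q = 1 then z else (1 - qpow q z) / (1 - q))"

definition qquot :: "'a::complete_nonarch_field \<Rightarrow> 'a \<Rightarrow> nat \<Rightarrow> 'a" where
  "qquot q x m = (if q = 1 then x / of_nat m else (1 - qpow q x) / (1 - q ^ m))"


section \<open>The p-adic q-integral and twisted q-Bernoulli values\<close>

text \<open>The p-adic integers are a subset of \<open>'a\<close>, and only the values of \<open>f\<close> on that subset (in fact
  on the natural numbers) enter. The limit exists when \<open>f\<close> is uniformly differentiable there.\<close>

definition q_integral :: "nat \<Rightarrow> 'a::complete_nonarch_field \<Rightarrow> ('a \<Rightarrow> 'a) \<Rightarrow> 'a" where
  "q_integral p Q f =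
     lim (\<lambda>M. 1 / qnum (of_nat (p ^ M)) Q * (\<Sum>y<p ^ M. f (of_nat y) * Q ^ y))"

text \<open>\<open>q_bernoulli p h n \<zeta> a m q\<close> is the value written \<open>\<beta>\<close> with indices \<open>h\<close>, \<open>n\<close>, \<open>\<zeta>\<close> at
  \<open>(a / m, q ^ m)\<close>.\<close>

definition q_bernoulli ::
  "nat \<Rightarrow> int \<Rightarrow> nat \<Rightarrow> 'a::complete_nonarch_field \<Rightarrow> int \<Rightarrow> nat \<Rightarrow> 'a \<Rightarrow> 'a" where
  "q_bernoulli p h n \<zeta> a m q =
     q_integral p (q ^ m)
       (\<lambda>y. qpow q (of_nat m * of_int (h - 1) * y) * rootpow \<zeta> y *
            qquot q (of_int a + of_nat m * y) m ^ n)"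


section \<open>Distributions on the inverse limit of the rings of integers modulo \<open>l * p ^ N\<close>\<close>

text \<open>Residue classes are represented by their least nonnegative representatives. The type
  \<open>nat \<Rightarrow> int\<close> carries the product of the discrete topologies, so that \<open>top_of_set (XX l p)\<close>
  is the inverse limit topology.\<close>

definition XX :: "nat \<Rightarrow> nat \<Rightarrow> (nat \<Rightarrow> int) set" where
  "XX l p = {x. \<forall>N. x N \<in> {0..<int (l * p ^ N)} \<and> [x (Suc N) = x N] (mod int (l * p ^ N))}"

definition Xball :: "nat \<Rightarrow> nat \<Rightarrow> int \<Rightarrow> nat \<Rightarrow> (nat \<Rightarrow> int) set" where
  "Xball l p a N = {x \<in> XX l p. [x N = a] (mod int (l * p ^ N))}"

definition compact_opens :: "'b::topological_space set \<Rightarrow> 'b set set" where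
  "compact_opens X = {U. compact U \<and> openin (top_of_set X) U}"

text \<open>A distribution is a function on the compact open subsets only; the extensional function
  space makes its value elsewhere the fixed dummy \<open>undefined\<close>, so that uniqueness can be stated
  with \<open>\<exists>!\<close>.\<close>

definition distributions :: "'b::topological_space set \<Rightarrow> ('b set \<Rightarrow> 'a::comm_monoid_add) set" where
  "distributions X =
     {\<nu> \<in> compact_opens X \<rightarrow>\<^sub>E UNIV.
        \<forall>\<U>. finite \<U> \<and> \<U> \<subseteq> compact_opens X \<and> disjoint \<U> \<longrightarrow> \<nu> (\<Union>\<U>) = (\<Sum>U\<in>\<U>. \<nu> U)}"

end

theory Submission
  imports Defs
begin

text \<open>Write \<open>[k] = 1 + q + \<dots> + q ^ (k - 1)\<close> and \<open>F x = q ^ (h x) \<xi> ^ x [x] ^ n\<close>. Because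
  \<open>[m k] = [m] [k; q ^ m]\<close>, the prescribed value on \<open>a + l p ^ N\<close> is the limit for \<open>M \<rightarrow> \<infinity>\<close> of
  \<open>(\<Sum>F x) / [l p ^ M]\<close>, where \<open>x\<close> runs over the numbers below \<open>l p ^ M\<close> in that ball. For fixed \<open>M\<close>
  this expression is additive in the ball, so the limits define a distribution as soon as
  they exist; and every compact open set is a finite disjoint union of balls, which gives uniqueness.

  For \<open>q \<noteq> 1\<close> the function \<open>F\<close> is a combination of exponentials \<open>(\<xi> q ^ k) ^ x\<close>, whose sums are
  geometric, and the limits exist because \<open>(s ^ p ^ M - 1) / p ^ M\<close> tends to the logarithm of \<open>s\<close>.
  For \<open>q = 1\<close> they reduce to the averages of \<open>\<zeta> ^ y y ^ j\<close> over \<open>y < p ^ M\<close>.\<close>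

section \<open>Complete non-archimedean fields\<close>

lemma absv_zero_iff [simp]: "absv x = 0 \<longleftrightarrow> x = (0::'a::complete_nonarch_field)"
  using dist_eq_0_iff[of x 0] by (simp add: dist_absv)

lemma absv_nonneg [simp]: "0 \<le> absv (x::'a::complete_nonarch_field)"
  using zero_le_dist[of x 0] by (simp add: dist_absv)

lemma absv_pos_iff [simp]: "0 < absv x \<longleftrightarrow> x \<noteq> (0::'a::complete_nonarch_field)"
  by (simp add: less_le eq_commute[of 0])

lemma absv_0 [simp]: "absv (0::'a::complete_nonarch_field) = 0"
  by simp

lemma absv_1 [simp]: "absv (1::'a::complete_nonarch_field) = 1"
  using absv_mult[of 1 "1::'a"] absv_zero_iff[of "1::'a"] by (metis mult_cancel_right1 mult_1 zero_neq_one)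

lemma absv_minus_commute: "absv (x - y) = absv (y - (x::'a::complete_nonarch_field))"
  by (metis dist_absv dist_commute)

lemma absv_minus [simp]: "absv (- x) = absv (x::'a::complete_nonarch_field)"
  using absv_minus_commute[of 0 x] by simp

lemma absv_diff_le: "absv (x - y) \<le> max (absv x) (absv (y::'a::complete_nonarch_field))"
  using absv_add_le[of x "- y"] by simp

lemma absv_power: "absv (x ^ n) = absv (x::'a::complete_nonarch_field) ^ n"
  by (induction n) (auto simp: absv_mult)

lemma absv_inverse: "absv (inverse x) = inverse (absv (x::'a::complete_nonarch_field))"
proof (cases "x = 0")
  case False
  then have "absv x * absv (inverse x) = 1"
    by (simp flip: absv_mult)
  then show ?thesis
    by (metis inverse_unique)
qed auto

lemma absv_divide: "absv (x / y) = absv x / absv (y::'a::complete_nonarch_field)"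
  by (simp add: divide_inverse absv_mult absv_inverse)

lemma absv_sum_le:
  fixes f :: "'b \<Rightarrow> 'a::complete_nonarch_field"
  assumes "\<And>i. i \<in> A \<Longrightarrow> absv (f i) \<le> B" "0 \<le> B"
  shows "absv (sum f A) \<le> B"
  using assms
proof (induction A rule: infinite_finite_induct)
  case (insert x F)
  then show ?case
    using absv_add_le[of "f x" "sum f F"] by (force intro: order_trans)
qed auto

text \<open>In \<open>x = (x + y) - y\<close> the term \<open>y\<close> is smaller than
  \<open>x\<close>, so if \<open>x + y\<close> were smaller than \<open>x\<close> as well, the
  ultrametric inequality would fail.\<close>

lemma absv_add_eq:
  fixes x y :: "'a::complete_nonarch_field"
  assumes "absv y < absv x"
  shows "absv (x + y) = absv x"
  using absv_add_le[of x y] absv_diff_le[of "x + y" y] assms by auto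

lemma absv_eq_if_close:
  fixes x y :: "'a::complete_nonarch_field"
  assumes "absv (x - y) < absv x"
  shows "absv y = absv x"
  using absv_add_eq[of "y - x" x] assms by (simp add: absv_minus_commute)

lemma absv_of_nat_le_1 [simp]: "absv (of_nat n :: 'a::complete_nonarch_field) \<le> 1"
proof (induction n)
  case (Suc n)
  then show ?case
    using absv_add_le[of "of_nat n :: 'a" 1] by (simp add: add.commute)
qed auto

lemma tendsto_absv_iff:
  fixes l :: "'a::complete_nonarch_field"
  shows "(f \<longlongrightarrow> l) F \<longleftrightarrow> ((\<lambda>x. absv (f x - l)) \<longlongrightarrow> 0) F"
  by (subst tendsto_dist_iff) (simp add: dist_absv)

lemma tendsto_absv_zeroI:
  fixes f :: "_ \<Rightarrow> 'a::complete_nonarch_field"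
  assumes "(g \<longlongrightarrow> 0) F" "\<forall>\<^sub>F x in F. absv (f x) \<le> g x"
  shows "(f \<longlongrightarrow> 0) F"
proof -
  have "((\<lambda>x. absv (f x)) \<longlongrightarrow> 0) F"
    by (rule real_tendsto_sandwich[OF _ assms(2) tendsto_const assms(1)]) auto
  then show ?thesis
    by (subst tendsto_absv_iff) simp
qed

section \<open>Limits of sums, products, quotients and series\<close>

instance complete_nonarch_field \<subseteq> topological_ab_group_add
proof
  fix a b :: 'a
  let ?F = "nhds a \<times>\<^sub>F nhds b"
  have "((\<lambda>x. max (absv (fst x - a)) (absv (snd x - b))) \<longlongrightarrow> max 0 0) ?F"
    by (intro tendsto_max; subst tendsto_absv_iff[symmetric]; rule filterlim_fst filterlim_snd)
  then have "((\<lambda>x. max (absv (fst x - a)) (absv (snd x - b))) \<longlongrightarrow> 0) ?F"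
    by simp
  then have "((\<lambda>x. (fst x + snd x) - (a + b)) \<longlongrightarrow> 0) ?F"
  proof (rule tendsto_absv_zeroI, intro always_eventually allI)
    show "absv ((fst x + snd x) - (a + b)) \<le> max (absv (fst x - a)) (absv (snd x - b))" for x
      using absv_add_le[of "fst x - a" "snd x - b"] by (simp add: algebra_simps)
  qed
  then show "LIM x ?F. fst x + snd x :> nhds (a + b)"
    by (subst (asm) tendsto_absv_iff, subst tendsto_absv_iff) simp
next
  fix a :: 'a
  have *: "((\<lambda>x. absv (x - a)) \<longlongrightarrow> 0) (nhds a)"
    by (subst tendsto_absv_iff[symmetric]) (rule filterlim_ident)
  show "(uminus \<longlongrightarrow> - a) (nhds a)"
    by (subst tendsto_absv_iff) (use * in \<open>simp add: absv_minus_commute add.commute\<close>)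
qed

lemma tendsto_absv:
  fixes l :: "'a::complete_nonarch_field"
  assumes "(f \<longlongrightarrow> l) F"
  shows "((\<lambda>x. absv (f x)) \<longlongrightarrow> absv l) F"
  using tendsto_dist[OF assms tendsto_const[of 0]] by (simp add: dist_absv)

instance complete_nonarch_field \<subseteq> topological_comm_monoid_mult
proof
  fix a b :: 'a
  let ?F = "nhds a \<times>\<^sub>F nhds b"
  have 1: "(fst \<longlongrightarrow> a) ?F" "(snd \<longlongrightarrow> b) ?F"
    by (rule filterlim_fst filterlim_snd)+
  then have "((\<lambda>x. max (absv (fst x - a) * absv (snd x)) (absv a * absv (snd x - b))) \<longlongrightarrow>
      max (0 * absv b) (absv a * 0)) ?F"
    by (intro tendsto_max tendsto_mult tendsto_const tendsto_absv;
        (subst tendsto_absv_iff[symmetric])?; assumption?)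
  then have "((\<lambda>x. max (absv (fst x - a) * absv (snd x)) (absv a * absv (snd x - b))) \<longlongrightarrow> 0) ?F"
    by simp
  then have "((\<lambda>x. (fst x * snd x) - (a * b)) \<longlongrightarrow> 0) ?F"
  proof (rule tendsto_absv_zeroI, intro always_eventually allI)
    show "absv ((fst x * snd x) - (a * b)) \<le> max (absv (fst x - a) * absv (snd x)) (absv a * absv (snd x - b))" for x
      using absv_add_le[of "(fst x - a) * snd x" "a * (snd x - b)"]
      by (simp add: absv_mult[symmetric] algebra_simps)
  qed
  then show "LIM x ?F. fst x * snd x :> nhds (a * b)"
    by (subst (asm) tendsto_absv_iff, subst tendsto_absv_iff) simp
qed

text \<open>The absolute value is locally constant away from 0: near \<open>l\<close> one has
  \<open>absv (f x) = absv l\<close>, so the inverses differ by \<open>absv (f x - l)\<close>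
  divided by the square of \<open>absv l\<close>.\<close>

lemma tendsto_inverse_nonarch:
  fixes l :: "'a::complete_nonarch_field"
  assumes f: "(f \<longlongrightarrow> l) F" and l: "l \<noteq> 0"
  shows "((\<lambda>x. inverse (f x)) \<longlongrightarrow> inverse l) F"
proof -
  have "((\<lambda>x. absv (f x - l) / (absv l * absv l)) \<longlongrightarrow> 0 / (absv l * absv l)) F"
    using f by (intro tendsto_intros) (auto simp: l tendsto_absv_iff[symmetric])
  moreover have "\<forall>\<^sub>F x in F. absv (f x - l) < absv l"
    using f l by (intro order_tendstoD(2)[of _ 0]) (auto simp: tendsto_absv_iff[symmetric] less_le)
  then have "\<forall>\<^sub>F x in F. absv (inverse (f x) - inverse l) \<le> absv (f x - l) / (absv l * absv l)"
  proof eventually_elim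
    case (elim x)
    then have "absv (f x) = absv l"
      by (intro absv_eq_if_close) (simp add: absv_minus_commute)
    moreover from this l have "f x \<noteq> 0"
      by auto
    ultimately show ?case
      using l by (simp add: inverse_diff_inverse absv_mult absv_inverse absv_minus_commute[of l] divide_inverse)
  qed
  ultimately have "((\<lambda>x. inverse (f x) - inverse l) \<longlongrightarrow> 0) F"
    by (intro tendsto_absv_zeroI) auto
  then show ?thesis
    by (subst (asm) tendsto_absv_iff, subst tendsto_absv_iff) simp
qed

lemma tendsto_divide_nonarch:
  fixes l :: "'a::complete_nonarch_field"
  assumes "(f \<longlongrightarrow> l) F" "(g \<longlongrightarrow> m) F" "m \<noteq> 0"
  shows "((\<lambda>x. f x / g x) \<longlongrightarrow> l / m) F"
  unfolding divide_inverse by (intro tendsto_mult tendsto_inverse_nonarch assms)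

lemma absv_limit_le:
  fixes s :: "'a::complete_nonarch_field"
  assumes "X \<longlonglongrightarrow> s" "\<forall>\<^sub>F n in sequentially. absv (X n) \<le> B"
  shows "absv s \<le> B"
  using tendsto_upperbound[OF tendsto_absv[OF assms(1)] assms(2)] by simp

text \<open>A block of consecutive terms is bounded by its largest term, so the partial sums are
  Cauchy as soon as the terms tend to 0.\<close>

lemma summable_nonarch:
  fixes f :: "nat \<Rightarrow> 'a::complete_nonarch_field"
  assumes "f \<longlonglongrightarrow> 0"
  shows "summable f"
proof -
  have "Cauchy (\<lambda>n. \<Sum>i<n. f i)"
  proof (rule metric_CauchyI)
    fix e :: real
    assume e: "e > 0"
    have "(\<lambda>n. absv (f n)) \<longlonglongrightarrow> 0"
      using tendsto_absv[OF assms] by simp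
    then have "\<forall>\<^sub>F n in sequentially. absv (f n) < e / 2"
      using e by (intro order_tendstoD) auto
    then obtain N where N: "\<And>n. n \<ge> N \<Longrightarrow> absv (f n) < e / 2"
      by (auto simp: eventually_sequentially)
    have *: "dist (\<Sum>i<n. f i) (\<Sum>i<m. f i) < e" if "N \<le> m" "m \<le> n" for m n
    proof -
      have "(\<Sum>i<n. f i) - (\<Sum>i<m. f i) = (\<Sum>i\<in>{m..<n}. f i)"
        using that by (simp add: sum_diff_nat_ivl lessThan_atLeast0)
      also have "absv \<dots> \<le> e / 2"
        using that N e by (intro absv_sum_le) (auto intro!: less_imp_le)
      finally show ?thesis
        using e by (simp add: dist_absv)
    qed
    show "\<exists>N. \<forall>m\<ge>N. \<forall>n\<ge>N. dist (\<Sum>i<m. f i) (\<Sum>i<n. f i) < e"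
    proof (intro exI allI impI)
      fix m n assume "N \<le> m" "N \<le> n"
      then show "dist (\<Sum>i<m. f i) (\<Sum>i<n. f i) < e"
        using *[of m n] *[of n m] by (cases "m \<le> n") (auto simp: dist_commute)
    qed
  qed
  then have "convergent (\<lambda>n. \<Sum>i<n. f i)"
    by (rule Cauchy_convergent)
  then show ?thesis
    by (auto simp: convergent_def summable_def sums_def)
qed

lemma absv_sums_diff_le:
  fixes f g :: "nat \<Rightarrow> 'a::complete_nonarch_field"
  assumes "f sums s" "g sums t" "\<And>k. absv (f k - g k) \<le> B"
  shows "absv (s - t) \<le> B"
proof (rule absv_limit_le)
  show "(\<lambda>n. (\<Sum>i<n. f i) - (\<Sum>i<n. g i)) \<longlonglongrightarrow> s - t"
    using assms unfolding sums_def by (intro tendsto_diff)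
  have "0 \<le> B"
    using assms(3)[of 0] absv_nonneg order_trans by blast
  then show "\<forall>\<^sub>F n in sequentially. absv ((\<Sum>i<n. f i) - (\<Sum>i<n. g i)) \<le> B"
    using assms(3) by (intro always_eventually allI) (auto simp flip: sum_subtractf intro!: absv_sum_le)
qed

section \<open>The p-adic exponential and logarithm\<close>

lemma one_plus_power_minus_one:
  "(1 + t) ^ n - 1 = (\<Sum>k<n. of_nat (n choose Suc k) * t ^ Suc k)" for t :: "'a::comm_ring_1"
proof -
  have "(1 + t) ^ n = (\<Sum>k\<le>n. of_nat (n choose k) * t ^ k)"
    by (subst add.commute) (simp add: binomial_ring)
  also have "\<dots> = (\<Sum>k<Suc n. of_nat (n choose k) * t ^ k)"
    by (simp add: lessThan_Suc_atMost)
  also have "\<dots> = 1 + (\<Sum>k<n. of_nat (n choose Suc k) * t ^ Suc k)"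
    by (subst sum.lessThan_Suc_shift) simp
  finally show ?thesis
    by simp
qed

section \<open>Absolute values of integers and factorials\<close>

locale padic_absv =
  fixes p :: nat and T :: "'a::complete_nonarch_field itself"
  assumes prime_p: "prime p" and absv_p: "absv (of_nat p :: 'a) = 1 / real p"
begin

lemma p_gt_1: "p > 1"
  using prime_p prime_gt_1_nat by blast

lemma absv_p_power: "absv (of_nat p ^ M :: 'a) = 1 / real p ^ M"
  by (simp add: absv_power absv_p power_divide)

lemma p_power_tendsto_0: "(\<lambda>M. of_nat p ^ M :: 'a) \<longlonglongrightarrow> 0"
proof (rule tendsto_absv_zeroI)
  show "(\<lambda>M. (1 / real p) ^ M) \<longlonglongrightarrow> 0"
    using p_gt_1 by (intro LIMSEQ_power_zero) auto
qed (simp add: absv_p_power power_divide)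

text \<open>Bezout gives \<open>u * p + v * b = 1\<close>. If \<open>b\<close> had absolute value
  below 1, so would both summands and hence 1.\<close>

lemma absv_of_nat_coprime:
  assumes "\<not> p dvd b"
  shows "absv (of_nat b :: 'a) = 1"
proof (rule ccontr)
  assume "absv (of_nat b :: 'a) \<noteq> 1"
  then have b: "absv (of_nat b :: 'a) < 1"
    by (simp add: less_le)
  have int_le: "absv (of_int z :: 'a) \<le> 1" for z
    by (cases z rule: int_cases2) auto
  have "coprime (int p) (int b)"
    using assms prime_p by (simp add: prime_imp_coprime)
  then obtain u v where uv: "u * int p + v * int b = 1"
    using bezout_int[of "int p" "int b"] by auto
  have "1 = of_int u * of_nat p + of_int v * (of_nat b :: 'a)"
    using arg_cong[OF uv, of "of_int :: int \<Rightarrow> 'a"] by simp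
  also have "absv \<dots> \<le> max (absv (of_nat p :: 'a)) (absv (of_nat b :: 'a))"
    using absv_add_le[of "of_int u * of_nat p" "of_int v * (of_nat b :: 'a)"]
      mult_right_mono[OF int_le[of u], of "absv (of_nat p :: 'a)"]
      mult_right_mono[OF int_le[of v], of "absv (of_nat b :: 'a)"]
    unfolding absv_mult by auto
  also have "\<dots> < 1"
    using b p_gt_1 by (simp add: absv_p)
  finally show False
    by simp
qed

text \<open>The \<open>p\<close>-part of \<open>n\<close> is at most \<open>n\<close>. This controls
  the denominators of the logarithm series.\<close>

lemma absv_of_nat_ge: "n > 0 \<Longrightarrow> 1 / real n \<le> absv (of_nat n :: 'a)"
proof (induction n rule: less_induct)
  case (less n)
  show ?case
  proof (cases "p dvd n")
    case True
    then obtain m where m: "n = p * m" ..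
    with less.prems p_gt_1 have "0 < m" "m < n"
      by auto
    then show ?thesis
      using less.IH[of m] p_gt_1 by (simp add: m absv_mult absv_p field_simps)
  next
    case False
    then show ?thesis
      using less.prems by (simp add: absv_of_nat_coprime)
  qed
qed

text \<open>The radius of convergence of \<open>padic_exp\<close>, and the bound imposed on
  \<open>absv (q - 1)\<close>.\<close>

definition rad :: real where
  "rad = real p powr (- 1 / (real p - 1))"

lemma rad_pos: "0 < rad" and rad_less_1: "rad < 1"
proof -
  show "0 < rad"
    using p_gt_1 by (simp add: rad_def)
  have "(1::real) < real p powr (1 / (real p - 1))"
    using p_gt_1 by (intro gr_one_powr) auto
  then show "rad < 1"
    using p_gt_1 by (simp add: rad_def powr_minus_divide divide_less_eq_1)
qed

lemma rad_power: "rad ^ (p - 1) = 1 / real p"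
proof -
  have "rad ^ (p - 1) = real p powr ((- 1 / (real p - 1)) * real (p - 1))"
    unfolding rad_def using p_gt_1 by (simp add: powr_powr powr_realpow[symmetric] del: powr_realpow)
  also have "(- 1 / (real p - 1)) * real (p - 1) = - 1"
    using p_gt_1 by (simp add: of_nat_diff)
  finally show ?thesis
    using p_gt_1 by (simp add: powr_minus_divide)
qed

lemma absv_fact_add:
  assumes "b < p"
  shows "absv (fact (p * a + b) :: 'a) = absv (fact (p * a) :: 'a)"
  using assms
proof (induction b)
  case (Suc b)
  have "\<not> p dvd p * a + Suc b"
    using Suc.prems by (metis dvd_add_triv_left_iff mult.commute nat_dvd_not_less zero_less_Suc dvd_triv_left dvd_add_right_iff)
  then have "absv (of_nat (p * a + Suc b) :: 'a) = 1"
    by (rule absv_of_nat_coprime)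
  moreover have "(fact (p * a + Suc b) :: 'a) = of_nat (p * a + Suc b) * fact (p * a + b)"
    by (metis add_Suc_right fact_Suc)
  ultimately show ?case
    using Suc by (simp add: absv_mult)
qed auto

text \<open>Legendre's formula in recursive form: of the factors of \<open>fact (p * a)\<close> only
  the multiples of \<open>p\<close> have absolute value below 1, and their product is
  \<open>p ^ a * fact a\<close>.\<close>

lemma absv_fact_mult: "absv (fact (p * a) :: 'a) = absv (fact a :: 'a) / real p ^ a"
proof (induction a)
  case (Suc a)
  have "p * Suc a = Suc (p * a + (p - 1))"
    using p_gt_1 by simp
  then have "(fact (p * Suc a) :: 'a) = of_nat (p * Suc a) * fact (p * a + (p - 1))"
    by (metis fact_Suc)
  moreover have "absv (fact (p * a + (p - 1)) :: 'a) = absv (fact a :: 'a) / real p ^ a"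
    using p_gt_1 by (subst absv_fact_add) (auto simp: Suc.IH)
  moreover have "(fact (Suc a) :: 'a) = of_nat (Suc a) * fact a"
    by (rule fact_Suc)
  ultimately show ?case
    by (simp only: absv_mult of_nat_mult absv_p) (simp add: field_simps)
qed auto

text \<open>By Legendre's formula the exponent of \<open>p\<close> in \<open>fact k\<close> is at
  most \<open>(k - 1) / (p - 1)\<close>. Having \<open>k - 1\<close> instead of \<open>k\<close>
  here is what yields \<open>absv (padic_exp x - 1) \<le> absv x\<close> later.\<close>

lemma absv_fact_ge: "k > 0 \<Longrightarrow> rad ^ (k - 1) \<le> absv (fact k :: 'a)"
proof (induction k rule: less_induct)
  case (less k)
  define a b where "a = k div p" and "b = k mod p"
  have k: "k = p * a + b" and b: "b < p"
    using p_gt_1 by (auto simp: a_def b_def)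
  have fact: "absv (fact k :: 'a) = absv (fact a :: 'a) / real p ^ a"
    unfolding k by (simp add: absv_fact_add[OF b] absv_fact_mult)
  show ?case
  proof (cases "a = 0")
    case True
    then show ?thesis
      using fact rad_pos rad_less_1 by (simp add: power_le_one)
  next
    case False
    then have "a < k"
      using p_gt_1 less.prems by (simp add: a_def)
    \<comment> \<open>The middle summand contributes \<open>(rad ^ (p - 1)) ^ a = 1 / p ^ a\<close>,
      the factor found in \<open>absv_fact_mult\<close>; \<open>a - 1\<close> belongs to the
      induction hypothesis, and \<open>rad ^ b\<close> is estimated by 1.\<close>
    have "k - 1 = (a - 1) + (p - 1) * a + b"
      using False p_gt_1 unfolding k by (cases a; cases p) (auto simp: algebra_simps)
    then have "rad ^ (k - 1) = rad ^ (a - 1) * (rad ^ (p - 1)) ^ a * rad ^ b"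
      by (simp add: power_add power_mult)
    also have "\<dots> \<le> rad ^ (a - 1) * (rad ^ (p - 1)) ^ a * 1"
      using rad_pos rad_less_1 by (intro mult_left_mono power_le_one) auto
    also have "\<dots> \<le> absv (fact k :: 'a)"
      using less.IH[OF \<open>a < k\<close>] False unfolding fact rad_power
      by (simp add: power_divide divide_right_mono)
    finally show ?thesis .
  qed
qed

section \<open>The exponential series\<close>

lemma absv_exp_term_le:
  fixes x :: 'a
  assumes "k > 0"
  shows "absv (x ^ k / fact k) \<le> absv x * (absv x / rad) ^ (k - 1)"
proof -
  have "absv (x ^ k / fact k) = absv x ^ k / absv (fact k :: 'a)"
    by (simp add: absv_divide absv_power)
  also have "\<dots> \<le> absv x ^ k / rad ^ (k - 1)"
    using absv_fact_ge[OF assms] rad_pos by (intro divide_left_mono) (auto intro!: mult_pos_pos simp: less_le)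
  also have "\<dots> = absv x * (absv x / rad) ^ (k - 1)"
    using assms by (cases k) (auto simp: power_divide)
  finally show ?thesis .
qed

text \<open>A geometric majorant with adjustable ratio, valid at \<open>k = 0\<close> too: the ratio
  is shared by two arguments in \<open>padic_exp_add\<close> and equals \<open>1 / p ^ M\<close> in
  \<open>padic_exp_p_power_tendsto\<close>.\<close>

lemma absv_exp_term_le_power:
  fixes x :: 'a
  assumes "absv x \<le> \<rho> * rad"
  shows "absv (x ^ k / fact k) \<le> \<rho> ^ k"
proof (cases "k = 0")
  case False
  have \<rho>: "absv x / rad \<le> \<rho>"
    using assms rad_pos by (simp add: field_simps)
  have "absv x \<le> absv x / rad"
    using rad_pos rad_less_1 mult_left_le_one_le[of "absv x" rad] by (simp add: field_simps)
  have "absv (x ^ k / fact k) \<le> absv x * (absv x / rad) ^ (k - 1)"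
    using False by (intro absv_exp_term_le) auto
  also have "\<dots> \<le> (absv x / rad) * (absv x / rad) ^ (k - 1)"
    using rad_pos \<open>absv x \<le> absv x / rad\<close> by (intro mult_right_mono) auto
  also have "\<dots> = (absv x / rad) ^ k"
    using False by (cases k) auto
  also have "\<dots> \<le> \<rho> ^ k"
    using \<rho> rad_pos by (intro power_mono) auto
  finally show ?thesis .
qed auto

lemma padic_exp_sums:
  fixes x :: 'a
  assumes "absv x < rad"
  shows "(\<lambda>k. x ^ k / fact k) sums padic_exp x"
proof -
  have "(\<lambda>k. x ^ k / fact k) \<longlonglongrightarrow> 0"
  proof (rule tendsto_absv_zeroI)
    show "(\<lambda>k. (absv x / rad) ^ k) \<longlonglongrightarrow> 0"
      using assms rad_pos by (intro LIMSEQ_power_zero) auto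
    show "\<forall>\<^sub>F k in sequentially. absv (x ^ k / fact k) \<le> (absv x / rad) ^ k"
      using rad_pos by (intro always_eventually allI absv_exp_term_le_power) auto
  qed
  then show ?thesis
    unfolding padic_exp_def by (intro summable_sums summable_nonarch)
qed

lemma padic_exp_0 [simp]: "padic_exp (0::'a) = 1"
proof -
  have "(\<lambda>k. (0::'a) ^ k / fact k) sums (\<Sum>k\<in>{0}. 0 ^ k / fact k)"
    by (intro sums_finite) (auto simp: power_0_left)
  then show ?thesis
    unfolding padic_exp_def by (auto dest: sums_unique)
qed

lemma padic_exp_minus_1_le:
  fixes x :: 'a
  assumes "absv x < rad"
  shows "absv (padic_exp x - 1) \<le> absv x"
proof (rule absv_sums_diff_le[OF padic_exp_sums[OF assms]])
  show "(\<lambda>k. if k = 0 then 1 else 0 :: 'a) sums 1"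
    using sums_single[of 0 "\<lambda>_. 1::'a"] by (simp add: eq_commute)
  show "absv (x ^ k / fact k - (if k = 0 then 1 else 0)) \<le> absv x" for k
  proof (cases "k = 0")
    case False
    have "absv x * (absv x / rad) ^ (k - 1) \<le> absv x * 1"
      using assms rad_pos by (intro mult_left_mono power_le_one) auto
    then show ?thesis
      using absv_exp_term_le[of k x] False by simp
  qed auto
qed

text \<open>The product of two partial sums runs over the square \<open>i, j < n\<close>, the
  partial sum for \<open>x + y\<close> over the triangle \<open>i + j < n\<close>. Every term of the
  difference has \<open>i + j \<ge> n\<close> and is at most \<open>\<rho> ^ n\<close>.\<close>

lemma padic_exp_add:
  fixes x y :: 'a
  assumes x: "absv x < rad" and y: "absv y < rad"
  shows "padic_exp (x + y) = padic_exp x * padic_exp y"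
proof -
  define \<rho> where "\<rho> = max (absv x) (absv y) / rad"
  have \<rho>: "0 \<le> \<rho>" "\<rho> < 1" "absv x \<le> \<rho> * rad" "absv y \<le> \<rho> * rad"
    using x y rad_pos by (auto simp: \<rho>_def le_max_iff_disj)
  let ?e = "\<lambda>x k. x ^ k / fact k :: 'a"
  have xy: "absv (x + y) < rad"
    using absv_add_le[of x y] x y by linarith
  have exp_eq: "(\<Sum>k<n. ?e (x + y) k) = (\<Sum>(i, j)\<in>{(i, j). i + j < n}. ?e x i * ?e y j)" for n
  proof -
    have "?e (x + y) k = (\<Sum>i\<le>k. ?e x i * ?e y (k - i))" for k
    proof -
      have "?e (x + y) k = (\<Sum>i\<le>k. of_nat (k choose i) * x ^ i * y ^ (k - i) / fact k)"
        by (simp add: binomial_ring sum_divide_distrib)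
      also have "\<dots> = (\<Sum>i\<le>k. ?e x i * ?e y (k - i))"
        by (intro sum.cong) (auto simp: binomial_fact)
      finally show ?thesis .
    qed
    then show ?thesis
      by (simp add: sum.triangle_reindex)
  qed
  have "(\<lambda>n. (\<Sum>k<n. ?e x k) * (\<Sum>k<n. ?e y k) - (\<Sum>k<n. ?e (x + y) k)) \<longlonglongrightarrow> 0"
  proof (rule tendsto_absv_zeroI)
    show "(\<lambda>n. \<rho> ^ n) \<longlonglongrightarrow> 0"
      using \<rho> by (intro LIMSEQ_power_zero) auto
    have "absv ((\<Sum>k<n. ?e x k) * (\<Sum>k<n. ?e y k) - (\<Sum>k<n. ?e (x + y) k)) \<le> \<rho> ^ n" for n
    proof -
      have sub: "{(i, j). i + j < n} \<subseteq> {..<n} \<times> {..<n}"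
        by auto
      have "(\<Sum>k<n. ?e x k) * (\<Sum>k<n. ?e y k) = (\<Sum>(i, j)\<in>{..<n} \<times> {..<n}. ?e x i * ?e y j)"
        by (simp add: sum_product sum.cartesian_product)
      then have "(\<Sum>k<n. ?e x k) * (\<Sum>k<n. ?e y k) - (\<Sum>k<n. ?e (x + y) k)
          = (\<Sum>(i, j)\<in>{..<n} \<times> {..<n} - {(i, j). i + j < n}. ?e x i * ?e y j)"
        unfolding exp_eq by (simp add: sum_diff[OF _ sub])
      also have "absv \<dots> \<le> \<rho> ^ n"
      proof (intro absv_sum_le; clarsimp simp: \<rho>)
        fix i j assume "i < n" "j < n" "\<not> i + j < n"
        have "absv (?e x i * ?e y j) \<le> \<rho> ^ i * \<rho> ^ j"
          unfolding absv_mult using \<rho> by (intro mult_mono absv_exp_term_le_power) auto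
        also have "\<dots> = \<rho> ^ (i + j)"
          by (simp add: power_add)
        also have "\<dots> \<le> \<rho> ^ n"
          using \<rho> \<open>\<not> i + j < n\<close> by (intro power_decreasing) auto
        finally show "absv (x ^ i * y ^ j / (fact i * fact j)) \<le> \<rho> ^ n"
          by simp
      qed
      finally show ?thesis .
    qed
    then show "\<forall>\<^sub>F n in sequentially. absv ((\<Sum>k<n. ?e x k) * (\<Sum>k<n. ?e y k) - (\<Sum>k<n. ?e (x + y) k)) \<le> \<rho> ^ n"
      by simp
  qed
  moreover have "(\<lambda>n. (\<Sum>k<n. ?e x k) * (\<Sum>k<n. ?e y k) - (\<Sum>k<n. ?e (x + y) k))
      \<longlonglongrightarrow> padic_exp x * padic_exp y - padic_exp (x + y)"
    using padic_exp_sums[OF x] padic_exp_sums[OF y] padic_exp_sums[OF xy]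
    unfolding sums_def by (intro tendsto_intros)
  ultimately have "padic_exp x * padic_exp y - padic_exp (x + y) = 0"
    by (rule LIMSEQ_unique[symmetric])
  then show ?thesis
    by simp
qed

lemma padic_exp_of_nat_mult:
  fixes x :: 'a
  assumes "absv x < rad"
  shows "padic_exp (of_nat n * x) = padic_exp x ^ n"
proof (induction n)
  case (Suc n)
  have "absv (of_nat n * x) \<le> 1 * absv x"
    unfolding absv_mult by (intro mult_right_mono) auto
  then show ?case
    using padic_exp_add[OF assms, of "of_nat n * x"] assms Suc by (simp add: algebra_simps)
qed auto

text \<open>The power is \<open>padic_exp (p ^ M * x)\<close>, which differs from
  \<open>1 + p ^ M * x\<close> by at most \<open>1 / p ^ (2 * M)\<close>; division by
  \<open>p ^ M\<close> leaves an error of at most \<open>1 / p ^ M\<close>.\<close>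

lemma padic_exp_p_power_tendsto:
  fixes x :: 'a
  assumes "absv x < rad"
  shows "(\<lambda>M. (padic_exp x ^ (p ^ M) - 1) / of_nat p ^ M) \<longlonglongrightarrow> x"
proof -
  have bound: "absv (padic_exp x ^ (p ^ M) - (1 + of_nat p ^ M * x)) \<le> (1 / real p ^ M)\<^sup>2" for M
  proof -
    let ?z = "of_nat p ^ M * x"
    have z: "absv ?z = absv x / real p ^ M"
      by (simp add: absv_mult absv_p_power)
    also have "\<dots> \<le> absv x / 1"
      using p_gt_1 by (intro divide_left_mono) auto
    also have "\<dots> < rad"
      using assms by simp
    finally have z_rad: "absv ?z < rad" .
    \<comment> \<open>The polynomial \<open>1 + ?z\<close> is written as a series so that it can be
      compared with the exponential series termwise; only terms with \<open>k \<ge> 2\<close>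
      remain.\<close>
    have "(\<lambda>k. if k \<in> {0, 1} then ?z ^ k / fact k else 0) sums (\<Sum>k\<in>{0, 1}. ?z ^ k / fact k)"
      by (intro sums_If_finite_set) auto
    then have *: "(\<lambda>k. if k \<in> {0, 1} then ?z ^ k / fact k else 0) sums (1 + ?z)"
      by simp
    have "absv (padic_exp ?z - (1 + ?z)) \<le> (1 / real p ^ M)\<^sup>2"
    proof (rule absv_sums_diff_le[OF padic_exp_sums[OF z_rad] *])
      fix k
      have "absv (?z ^ k / fact k) \<le> (1 / real p ^ M)\<^sup>2" if "k \<notin> {0, 1}"
      proof -
        have "absv (?z ^ k / fact k) \<le> (1 / real p ^ M) ^ k"
          using assms by (intro absv_exp_term_le_power) (simp add: z divide_right_mono)
        also have "\<dots> \<le> (1 / real p ^ M)\<^sup>2"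
          using that p_gt_1 by (intro power_decreasing) auto
        finally show ?thesis .
      qed
      then show "absv (?z ^ k / fact k - (if k \<in> {0, 1} then ?z ^ k / fact k else 0)) \<le> (1 / real p ^ M)\<^sup>2"
        by auto
    qed
    then show ?thesis
      using padic_exp_of_nat_mult[OF assms, of "p ^ M"] by simp
  qed
  have p0: "of_nat p \<noteq> (0::'a)"
    using p_gt_1 by simp
  have "(\<lambda>M. (padic_exp x ^ (p ^ M) - 1) / of_nat p ^ M - x) \<longlonglongrightarrow> 0"
  proof (rule tendsto_absv_zeroI)
    show "(\<lambda>M. (1 / real p) ^ M) \<longlonglongrightarrow> 0"
      using p_gt_1 by (intro LIMSEQ_power_zero) auto
    have "absv ((padic_exp x ^ (p ^ M) - 1) / of_nat p ^ M - x) \<le> (1 / real p) ^ M" for M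
    proof -
      have "(padic_exp x ^ (p ^ M) - 1) / of_nat p ^ M - x
          = (padic_exp x ^ (p ^ M) - (1 + of_nat p ^ M * x)) / of_nat p ^ M"
        using p0 by (simp add: field_simps)
      also have "absv \<dots> \<le> (1 / real p ^ M)\<^sup>2 / (1 / real p ^ M)"
        unfolding absv_divide absv_p_power by (intro divide_right_mono bound) simp
      finally show ?thesis
        using p_gt_1 by (simp add: power2_eq_square power_divide)
    qed
    then show "\<forall>\<^sub>F M in sequentially. absv ((padic_exp x ^ (p ^ M) - 1) / of_nat p ^ M - x) \<le> (1 / real p) ^ M"
      by simp
  qed
  then show ?thesis
    by (subst (asm) tendsto_absv_iff, subst tendsto_absv_iff) simp
qed

section \<open>Powers \<open>w ^ (p ^ M)\<close> near 1 and the logarithm\<close>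

lemma absv_power_p_minus_1:
  fixes w :: 'a
  assumes w: "absv (w - 1) < rad"
  shows "absv (w ^ p - 1) = absv (w - 1) / real p"
proof (cases "w = 1")
  case False
  define t where "t = w - 1"
  have t: "absv t < rad" "0 < absv t"
    using w False by (auto simp: t_def less_le)
  obtain k where k: "p = Suc (Suc k)"
    using p_gt_1 that[of "p - 2"] by simp
  define B where "B = max (absv t / real p) (absv t ^ (p - 1))"
  have "absv t ^ (p - 1) < rad ^ (p - 1)"
    using t rad_pos p_gt_1 by (intro power_strict_mono) auto
  then have "absv t ^ (p - 1) < 1 / real p"
    unfolding rad_power .
  moreover have "absv t < 1"
    using t rad_less_1 by simp
  ultimately have B: "B < 1 / real p"
    unfolding B_def max_less_iff_conj using p_gt_1 by (intro conjI divide_strict_right_mono) auto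
  \<comment> \<open>Here \<open>w ^ p - 1 = t * (p + s)\<close>. The inner binomial coefficients in
    \<open>s\<close> are divisible by \<open>p\<close> and come with a power of \<open>t\<close>;
    the last term \<open>t ^ (p - 1)\<close> is smaller than \<open>1 / p\<close> because
    \<open>absv t < rad\<close>. Hence \<open>p\<close> dominates \<open>s\<close>.\<close>
  define s where "s = (\<Sum>j<Suc k. of_nat (p choose Suc (Suc j)) * t ^ Suc j)"
  have "absv s \<le> B"
    unfolding s_def
  proof (rule absv_sum_le)
    fix j assume j: "j \<in> {..<Suc k}"
    show "absv (of_nat (p choose Suc (Suc j)) * t ^ Suc j) \<le> B"
    proof (cases "j = k")
      case True
      then show ?thesis
        using k by (simp add: B_def absv_power absv_mult)
    next
      case False
      then have "p dvd p choose Suc (Suc j)"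
        using j k prime_p by (intro dvd_choose_prime) auto
      then obtain c where c: "p choose Suc (Suc j) = p * c" ..
      have "absv (of_nat (p choose Suc (Suc j)) * t ^ Suc j) = absv (of_nat c :: 'a) * absv t ^ j * (absv t / real p)"
        unfolding c by (simp add: absv_mult absv_power absv_p)
      also have "\<dots> \<le> 1 * 1 * (absv t / real p)"
        using \<open>absv t < 1\<close> by (intro mult_mono power_le_one) auto
      finally show ?thesis
        by (simp add: B_def)
    qed
  qed (auto simp: B_def le_max_iff_disj)
  then have "absv (of_nat p + s) = absv (of_nat p :: 'a)"
    using B by (intro absv_add_eq) (simp add: absv_p)
  moreover have "w ^ p - 1 = t * (of_nat p + s)"
    using one_plus_power_minus_one[of t p]
    by (simp add: t_def s_def k sum.lessThan_Suc_shift[of _ "Suc k"] sum_distrib_left algebra_simps del: sum.lessThan_Suc)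
  ultimately show ?thesis
    by (simp add: absv_mult absv_p t_def)
qed auto

lemma absv_power_p_power_minus_1:
  fixes w :: 'a
  assumes w: "absv (w - 1) < rad"
  shows "absv (w ^ (p ^ M) - 1) = absv (w - 1) / real p ^ M"
proof (induction M)
  case (Suc M)
  have "absv (w - 1) / real p ^ M \<le> absv (w - 1) / 1"
    using p_gt_1 by (intro divide_left_mono) auto
  then have "absv (w ^ (p ^ M) - 1) < rad"
    using w Suc by simp
  then show ?case
    using absv_power_p_minus_1[of "w ^ (p ^ M)"] Suc by (simp add: power_mult[symmetric] mult.commute)
qed auto

lemma power_p_power_tendsto_1:
  fixes w :: 'a
  assumes w: "absv (w - 1) < rad"
  shows "(\<lambda>M. w ^ (p ^ M)) \<longlonglongrightarrow> 1"
proof -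
  have "(\<lambda>M. absv (w - 1) * (1 / real p) ^ M) \<longlonglongrightarrow> absv (w - 1) * 0"
    using p_gt_1 by (intro tendsto_mult tendsto_const LIMSEQ_power_zero) auto
  then show ?thesis
    by (subst tendsto_absv_iff) (simp add: absv_power_p_power_minus_1[OF w] power_divide)
qed

text \<open>As \<open>p ^ M - 1\<close> tends to -1, the limit is the binomial coefficient of -1
  over \<open>k\<close>. The induction uses Pascal's rule, in which
  \<open>p ^ M choose Suc k\<close> tends to 0 because it contains the factor
  \<open>p ^ M / Suc k\<close>.\<close>

lemma binomial_p_power_minus_1_tendsto:
  "(\<lambda>M. of_nat ((p ^ M - 1) choose k) :: 'a) \<longlonglongrightarrow> (- 1) ^ k"
proof (induction k)
  case (Suc k)
  have eq: "of_nat ((p ^ M - 1) choose Suc k)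
      = of_nat p ^ M / of_nat (Suc k) * of_nat ((p ^ M - 1) choose k) - (of_nat ((p ^ M - 1) choose k) :: 'a)" for M
  proof -
    obtain m where m: "p ^ M = Suc m"
      using p_gt_1 by (metis gr0_implies_Suc not_less_zero zero_less_power less_nat_zero_code neq0_conv)
    have "of_nat (Suc k) * of_nat (Suc m choose Suc k) = of_nat (Suc m) * (of_nat (m choose k) :: 'a)"
      by (metis Suc_times_binomial of_nat_mult)
    then have "of_nat (Suc m choose Suc k) = of_nat (Suc m) / of_nat (Suc k) * (of_nat (m choose k) :: 'a)"
      by (simp add: field_simps del: binomial_Suc_Suc of_nat_Suc)
    moreover have "of_nat p ^ M = (of_nat (Suc m) :: 'a)"
      by (metis m of_nat_power)
    ultimately show ?thesis
      by (simp add: m algebra_simps)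
  qed
  have "(\<lambda>M. of_nat p ^ M / of_nat (Suc k) * of_nat ((p ^ M - 1) choose k) - (of_nat ((p ^ M - 1) choose k) :: 'a))
      \<longlonglongrightarrow> 0 / of_nat (Suc k) * (- 1) ^ k - (- 1) ^ k"
    by (intro tendsto_intros tendsto_divide_nonarch p_power_tendsto_0 Suc) (simp del: of_nat_Suc)
  then show ?case
    unfolding eq by simp
qed auto

text \<open>After division by \<open>p ^ M\<close>, the coefficient of \<open>t ^ Suc k\<close> in
  \<open>(1 + t) ^ (p ^ M) - 1\<close> is \<open>((p ^ M - 1) choose k) / Suc k\<close>, which tends
  to the coefficient of the logarithm. Binomial coefficients have absolute value at most 1, so the
  tails are small uniformly in \<open>M\<close>.\<close>

lemma p_power_tendsto_padic_log:
  fixes q :: 'a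
  assumes q: "absv (q - 1) < 1"
  shows "(\<lambda>M. (q ^ (p ^ M) - 1) / of_nat p ^ M) \<longlonglongrightarrow> padic_log q"
proof -
  define t where "t = q - 1"
  have p0: "of_nat p \<noteq> (0::'a)"
    using p_gt_1 by simp
  let ?c = "\<lambda>k. t ^ Suc k / of_nat (Suc k)"
  let ?b = "\<lambda>M k. of_nat ((p ^ M - 1) choose k) :: 'a"
  have "(\<lambda>k. ?c k) \<longlonglongrightarrow> 0"
  proof (rule tendsto_absv_zeroI)
    have "(\<lambda>k. real k * absv t ^ k) \<longlonglongrightarrow> 0"
      using q by (intro powser_times_n_limit_0) (simp add: t_def)
    then show "(\<lambda>k. real (Suc k) * absv t ^ Suc k) \<longlonglongrightarrow> 0"
      by (rule LIMSEQ_Suc)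
    have "absv (?c k) \<le> real (Suc k) * absv t ^ Suc k" for k
    proof -
      have "absv (?c k) = absv t ^ Suc k / absv (of_nat (Suc k) :: 'a)"
        by (simp add: absv_divide absv_power absv_mult del: of_nat_Suc)
      also have "\<dots> \<le> absv t ^ Suc k / (1 / real (Suc k))"
        by (intro divide_left_mono absv_of_nat_ge mult_pos_pos) (auto simp: less_le simp del: of_nat_Suc)
      finally show ?thesis
        by (simp add: mult.commute)
    qed
    then show "\<forall>\<^sub>F k in sequentially. absv (?c k) \<le> real (Suc k) * absv t ^ Suc k"
      by simp
  qed
  then have c: "(\<lambda>k. absv (?c k)) \<longlonglongrightarrow> 0"
    using tendsto_absv by fastforce
  have sign: "absv ((-1) ^ k :: 'a) = 1" for k
    by (simp add: absv_power)
  have log: "(\<lambda>k. (-1) ^ k * ?c k) sums padic_log q"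
  proof -
    have "(\<lambda>k. (-1) ^ k * ?c k) \<longlonglongrightarrow> 0"
      by (rule tendsto_absv_zeroI[OF c]) (simp only: absv_mult sign, simp)
    then show ?thesis
      unfolding padic_log_def t_def by (auto dest: summable_nonarch summable_sums)
  qed
  have pow: "(\<lambda>k. ?b M k * ?c k) sums ((q ^ (p ^ M) - 1) / of_nat p ^ M)" for M
  proof -
    \<comment> \<open>The finite expansion becomes a series because the binomial coefficients vanish
      from \<open>k = p ^ M\<close> on.\<close>
    have "(\<lambda>k. ?b M k * ?c k) sums (\<Sum>k<p ^ M. ?b M k * ?c k)"
    proof (intro sums_finite)
      fix k assume "k \<notin> {..<p ^ M}"
      then have "p ^ M \<le> k"
        by simp
      moreover have "p ^ M > 0"
        using p_gt_1 by simp
      ultimately have "(p ^ M - 1) choose k = 0"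
        by (intro binomial_eq_0) linarith
      then show "?b M k * ?c k = 0"
        by simp
    qed simp
    also have "(\<Sum>k<p ^ M. ?b M k * ?c k) = (\<Sum>k<p ^ M. of_nat (p ^ M choose Suc k) * t ^ Suc k) / of_nat p ^ M"
      unfolding sum_divide_distrib
    proof (intro sum.cong refl)
      fix k
      have "of_nat (Suc k) * of_nat (p ^ M choose Suc k) = of_nat p ^ M * ?b M k"
        by (metis binomial_absorption of_nat_mult of_nat_power)
      then have "of_nat (p ^ M choose Suc k) = of_nat p ^ M * ?b M k / of_nat (Suc k)"
        by (simp add: field_simps del: of_nat_Suc)
      then show "?b M k * ?c k = of_nat (p ^ M choose Suc k) * t ^ Suc k / of_nat p ^ M"
        using p0 by (simp del: of_nat_Suc)
    qed
    finally show ?thesis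
      using one_plus_power_minus_one[of t "p ^ M"] by (simp add: t_def)
  qed
  show ?thesis
  proof (rule metric_LIMSEQ_I)
    fix e :: real assume e: "e > 0"
    have "\<forall>\<^sub>F k in sequentially. absv (?c k) < e / 2"
      using c e by (intro order_tendstoD) auto
    then obtain K where K: "\<And>k. k \<ge> K \<Longrightarrow> absv (?c k) < e / 2"
      by (auto simp: eventually_sequentially)
    have "\<forall>\<^sub>F M in sequentially. absv (?b M k * ?c k - (-1) ^ k * ?c k) < e / 2" for k
    proof -
      have "(\<lambda>M. ?b M k * ?c k - (-1) ^ k * ?c k) \<longlonglongrightarrow> (-1) ^ k * ?c k - (-1) ^ k * ?c k"
        by (intro tendsto_intros binomial_p_power_minus_1_tendsto)
      then have "(\<lambda>M. absv (?b M k * ?c k - (-1) ^ k * ?c k)) \<longlonglongrightarrow> 0"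
        using tendsto_absv by fastforce
      then show ?thesis
        using e by (intro order_tendstoD) auto
    qed
    \<comment> \<open>Only the finitely many indices below \<open>K\<close> require \<open>M\<close>
      to be large; from \<open>K\<close> on the terms are small for every \<open>M\<close>.\<close>
    then have "\<forall>\<^sub>F M in sequentially. \<forall>k\<in>{..<K}. absv (?b M k * ?c k - (-1) ^ k * ?c k) < e / 2"
      by (intro eventually_ball_finite) auto
    then obtain M0 where M0: "\<And>M k. M \<ge> M0 \<Longrightarrow> k < K \<Longrightarrow> absv (?b M k * ?c k - (-1) ^ k * ?c k) < e / 2"
      unfolding eventually_sequentially by blast
    have "dist ((q ^ (p ^ M) - 1) / of_nat p ^ M) (padic_log q) < e" if "M \<ge> M0" for M
    proof -
      have "absv (?b M k * ?c k - (-1) ^ k * ?c k) \<le> e / 2" for k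
      proof (cases "k < K")
        case True
        then show ?thesis
          using M0[OF that, of k] by simp
      next
        case False
        have "absv (?b M k - (-1) ^ k) \<le> 1"
          using absv_diff_le[of "?b M k" "(-1) ^ k"] by (simp add: sign)
        then have "absv (?b M k - (-1) ^ k) * absv (?c k) \<le> 1 * absv (?c k)"
          by (intro mult_right_mono) auto
        then have "absv (?b M k * ?c k - (-1) ^ k * ?c k) \<le> absv (?c k)"
          by (simp only: absv_mult[symmetric] left_diff_distrib mult_1)
        then show ?thesis
          using K[of k] False by linarith
      qed
      then have "absv ((q ^ (p ^ M) - 1) / of_nat p ^ M - padic_log q) \<le> e / 2"
        by (rule absv_sums_diff_le[OF pow log])
      then show ?thesis
        using e by (simp add: dist_absv)
    qed
    then show "\<exists>M0. \<forall>M\<ge>M0. dist ((q ^ (p ^ M) - 1) / of_nat p ^ M) (padic_log q) < e"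
      by blast
  qed
qed

text \<open>Every approximant \<open>(q ^ (p ^ M) - 1) / p ^ M\<close> has absolute value exactly
  \<open>absv (q - 1)\<close>.\<close>

lemma absv_padic_log_le:
  fixes q :: 'a
  assumes q: "absv (q - 1) < rad"
  shows "absv (padic_log q) \<le> absv (q - 1)"
proof (rule absv_limit_le[OF p_power_tendsto_padic_log])
  show "absv (q - 1) < 1"
    using q rad_less_1 by simp
  show "\<forall>\<^sub>F M in sequentially. absv ((q ^ (p ^ M) - 1) / of_nat p ^ M) \<le> absv (q - 1)"
    using p_gt_1 by (intro always_eventually allI)
      (simp add: absv_divide absv_p_power absv_power_p_power_minus_1[OF q])
qed

lemma absv_eq_1:
  fixes q :: 'a
  assumes "absv (q - 1) < 1"
  shows "absv q = 1"
  using absv_eq_if_close[of 1 q] assms by (simp add: absv_minus_commute)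

text \<open>With \<open>w = exp (log q) / q\<close>, both \<open>exp (log q) ^ p ^ M\<close> and \<open>q ^ p ^ M\<close> are
  \<open>1 + p ^ M log q + o(p ^ M)\<close>, so \<open>w ^ p ^ M - 1\<close> is \<open>o(p ^ M)\<close>; but its absolute value is
  \<open>absv (w - 1) / p ^ M\<close>.\<close>

lemma padic_exp_log:
  fixes q :: 'a
  assumes q: "absv (q - 1) < rad"
  shows "padic_exp (padic_log q) = q"
proof -
  let ?E = "padic_exp (padic_log q)"
  define w where "w = ?E / q"
  have L: "absv (padic_log q) < rad"
    using absv_padic_log_le[OF q] q by simp
  have q1: "absv (q - 1) < 1"
    using q rad_less_1 by simp
  have aq: "absv q = 1"
    by (rule absv_eq_1[OF q1])
  then have q0: "q \<noteq> 0"
    by auto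
  have "absv (?E - q) < rad"
    using absv_diff_le[of "?E - 1" "q - 1"] padic_exp_minus_1_le[OF L] L q by simp
  moreover have "w - 1 = (?E - q) / q"
    using q0 by (simp add: w_def diff_divide_distrib)
  ultimately have w: "absv (w - 1) < rad"
    by (simp add: absv_divide aq)
  have p0: "of_nat p \<noteq> (0::'a)"
    using p_gt_1 by simp
  have "(\<lambda>M. (?E ^ (p ^ M) - 1) / of_nat p ^ M - (q ^ (p ^ M) - 1) / of_nat p ^ M) \<longlonglongrightarrow> padic_log q - padic_log q"
    by (intro tendsto_diff padic_exp_p_power_tendsto p_power_tendsto_padic_log L q1)
  then have "(\<lambda>M. absv ((?E ^ (p ^ M) - 1) / of_nat p ^ M - (q ^ (p ^ M) - 1) / of_nat p ^ M)) \<longlonglongrightarrow> 0"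
    using tendsto_absv by fastforce
  moreover have "absv ((?E ^ (p ^ M) - 1) / of_nat p ^ M - (q ^ (p ^ M) - 1) / of_nat p ^ M) = absv (w - 1)" for M
  proof -
    have "(?E ^ (p ^ M) - 1) / of_nat p ^ M - (q ^ (p ^ M) - 1) / of_nat p ^ M
        = q ^ (p ^ M) * (w ^ (p ^ M) - 1) / of_nat p ^ M"
      using q0 p0 by (simp add: w_def power_divide field_simps)
    then show ?thesis
      using p_gt_1
      by (simp add: absv_divide absv_mult absv_power aq absv_p_power absv_p absv_power_p_power_minus_1[OF w] power_divide)
  qed
  ultimately have "absv (w - 1) = 0"
    by (simp add: LIMSEQ_const_iff)
  then show ?thesis
    using q0 by (simp add: w_def)
qed

section \<open>Integer powers of \<open>q\<close>\<close>

lemma absv_power_minus_1_le: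
  fixes q :: 'a
  assumes "absv (q - 1) < 1"
  shows "absv (q ^ k - 1) \<le> absv (q - 1)"
proof -
  have "absv (\<Sum>i<k. q ^ i) \<le> 1"
    using absv_eq_1[OF assms] by (intro absv_sum_le) (auto simp: absv_power)
  then have "absv (q - 1) * absv (\<Sum>i<k. q ^ i) \<le> absv (q - 1) * 1"
    by (intro mult_left_mono) auto
  then show ?thesis
    by (simp add: power_diff_1_eq absv_mult)
qed

lemma absv_power_int_minus_1_le:
  fixes q :: 'a
  assumes q: "absv (q - 1) < 1"
  shows "absv (q powi k - 1) \<le> absv (q - 1)"
proof (cases "0 \<le> k")
  case True
  then show ?thesis
    using absv_power_minus_1_le[OF q] by (simp add: power_int_def)
next
  case False
  have "q \<noteq> 0"
    using absv_eq_1[OF q] by auto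
  then have "inverse (q ^ nat (- k)) - 1 = - (q ^ nat (- k) - 1) / q ^ nat (- k)"
    by (simp add: field_simps)
  moreover have "absv (- (q ^ nat (- k) - 1) / q ^ nat (- k)) \<le> absv (q - 1)"
    using absv_power_minus_1_le[OF q] absv_eq_1[OF q] by (simp only: absv_divide absv_minus) (simp add: absv_power)
  ultimately show ?thesis
    using False by (simp add: power_int_def power_inverse)
qed

text \<open>This makes the analytic power algebraic at integer exponents, the only ones met at the
  sample points of the integrals.\<close>

lemma qpow_of_int:
  fixes q :: 'a
  assumes q: "absv (q - 1) < rad"
  shows "qpow q (of_int k) = q powi k"
proof -
  have L: "absv (padic_log q) < rad"
    using absv_padic_log_le[OF q] q by simp
  have nat: "padic_exp (of_nat j * padic_log q) = q ^ j" for j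
    by (simp add: padic_exp_of_nat_mult[OF L] padic_exp_log[OF q])
  show ?thesis
  proof (cases "0 \<le> k")
    case True
    then show ?thesis
      using nat[of "nat k"] by (simp add: qpow_def power_int_def)
  next
    case False
    define j where "j = nat (- k)"
    have k: "(of_int k :: 'a) = - of_nat j"
      using False by (simp add: j_def)
    have "absv (of_nat j * padic_log q) \<le> 1 * absv (padic_log q)"
      unfolding absv_mult by (intro mult_right_mono) auto
    then have j: "absv (of_nat j * padic_log q) < rad"
      using L by simp
    have "padic_exp (of_nat j * padic_log q) * padic_exp (- (of_nat j * padic_log q)) = 1"
      using padic_exp_add[of "of_nat j * padic_log q" "- (of_nat j * padic_log q)"] j by simp
    then have "q ^ j * qpow q (of_int k) = 1"
      by (simp add: qpow_def nat k)
    then have "qpow q (of_int k) = inverse (q ^ j)"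
      by (metis inverse_unique)
    then show ?thesis
      using False by (simp add: power_int_def j_def power_inverse)
  qed
qed

text \<open>The geometric sums of \<open>q ^ (p ^ M)\<close> with \<open>m\<close> terms tend to
  \<open>m\<close>, which is nonzero in characteristic 0. So \<open>q ^ (p ^ M) = 1\<close> for some
  \<open>M\<close>, and the exact size of \<open>q ^ (p ^ M) - 1\<close> forces
  \<open>q = 1\<close>. This keeps the denominators \<open>1 - q ^ m\<close> nonzero for
  \<open>q \<noteq> 1\<close>.\<close>

lemma power_eq_1_imp_eq_1:
  fixes q :: 'a
  assumes q: "absv (q - 1) < rad" and "q ^ m = 1" "m > 0"
  shows "q = 1"
proof -
  have "(\<lambda>M. \<Sum>i<m. (q ^ (p ^ M)) ^ i) \<longlonglongrightarrow> (\<Sum>i<m. 1 ^ i)"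
    by (intro tendsto_intros power_p_power_tendsto_1 q)
  then have "(\<lambda>M. absv (\<Sum>i<m. (q ^ (p ^ M)) ^ i)) \<longlonglongrightarrow> absv (of_nat m :: 'a)"
    using tendsto_absv by fastforce
  moreover have "absv (of_nat m :: 'a) > 0"
    using \<open>m > 0\<close> by simp
  ultimately have "\<forall>\<^sub>F M in sequentially. absv (\<Sum>i<m. (q ^ (p ^ M)) ^ i) > 0"
    by (rule order_tendstoD)
  then obtain M where "absv (\<Sum>i<m. (q ^ (p ^ M)) ^ i) > 0"
    using eventually_happens trivial_limit_sequentially by blast
  then have M: "(\<Sum>i<m. (q ^ (p ^ M)) ^ i) \<noteq> 0"
    by force
  have "(q ^ (p ^ M)) ^ m = (q ^ m) ^ (p ^ M)"
    by (simp add: mult.commute flip: power_mult)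
  then have "(q ^ (p ^ M) - 1) * (\<Sum>i<m. (q ^ (p ^ M)) ^ i) = 0"
    by (simp add: \<open>q ^ m = 1\<close> flip: power_diff_1_eq)
  with M have "absv (q ^ (p ^ M) - 1) = 0"
    by simp
  then show ?thesis
    using p_gt_1 by (simp add: absv_power_p_power_minus_1[OF q])
qed

end

section \<open>Convergence of the averages\<close>

text \<open>The number \<open>[k; q]\<close> as a polynomial in \<open>q\<close>, so that one
  expression covers \<open>q = 1\<close> as well.\<close>

definition qcount :: "'a::comm_ring_1 \<Rightarrow> nat \<Rightarrow> 'a" where
  "qcount q k = (\<Sum>i<k. q ^ i)"

lemma qcount_1 [simp]: "qcount 1 k = of_nat k"
  by (simp add: qcount_def)

lemma qcount_eq_divide: "q \<noteq> 1 \<Longrightarrow> qcount q k = (1 - q ^ k) / (1 - q)" for q :: "'a::field"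
  by (simp add: qcount_def sum_gp_strict)

lemma qcount_add: "qcount q (a + b) = qcount q a + q ^ a * qcount q b"
  by (induction b) (auto simp: qcount_def algebra_simps power_add)

text \<open>It merges \<open>[m; q]\<close> and the normalisation \<open>[p ^ M; q ^ m]\<close> of
  the integral into \<open>[m * p ^ M; q]\<close>.\<close>

lemma qcount_mult: "qcount q (a * b) = qcount q a * qcount (q ^ a) b"
proof (induction b)
  case (Suc b)
  have "qcount (q ^ a) (Suc b) = qcount (q ^ a) b + q ^ (a * b)"
    by (simp add: qcount_def power_mult)
  moreover have "a * Suc b = a * b + a"
    by simp
  ultimately show ?case
    using Suc by (simp only: qcount_add) (simp add: algebra_simps)
qed (simp add: qcount_def)

definition q_integrand :: "int \<Rightarrow> nat \<Rightarrow> 'a::field \<Rightarrow> 'a \<Rightarrow> nat \<Rightarrow> 'a" where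
  "q_integrand h n \<xi> q x = q powi (h * int x) * \<xi> ^ x * qcount q x ^ n"

lemma convergent_const_mult:
  fixes X :: "nat \<Rightarrow> 'a::complete_nonarch_field"
  assumes "convergent X"
  shows "convergent (\<lambda>n. c * X n)"
proof -
  obtain L where "X \<longlonglongrightarrow> L"
    using assms by (auto simp: convergent_def)
  then have "(\<lambda>n. c * X n) \<longlonglongrightarrow> c * L"
    by (intro tendsto_mult tendsto_const)
  then show ?thesis
    by (rule convergentI)
qed

lemma convergent_sum_nonarch:
  fixes X :: "'i \<Rightarrow> nat \<Rightarrow> 'a::complete_nonarch_field"
  assumes "\<And>i. i \<in> I \<Longrightarrow> convergent (X i)"
  shows "convergent (\<lambda>n. \<Sum>i\<in>I. X i n)"
proof -
  have "(\<lambda>n. \<Sum>i\<in>I. X i n) \<longlonglongrightarrow> (\<Sum>i\<in>I. lim (X i))"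
    using assms by (intro tendsto_sum) (simp add: convergent_LIMSEQ_iff)
  then show ?thesis
    by (rule convergentI)
qed

lemma Tp_power:
  assumes "\<zeta> \<in> Tp p"
  shows "\<zeta> ^ m \<in> Tp p"
proof -
  obtain k where "\<zeta> ^ (p ^ k) = 1"
    using assms by (auto simp: Tp_def)
  then have "(\<zeta> ^ m) ^ (p ^ k) = 1"
    by (simp only: power_mult[symmetric] mult.commute[of m]) (simp add: power_mult)
  then show ?thesis
    by (auto simp: Tp_def)
qed

lemma Tp_nonzero: "p > 0 \<Longrightarrow> \<zeta> \<in> Tp p \<Longrightarrow> \<zeta> \<noteq> 0"
  by (auto simp: Tp_def power_0_left)

lemma Tp_eventually:
  assumes "\<zeta> \<in> Tp p"
  shows "\<forall>\<^sub>F M in sequentially. \<zeta> ^ (p ^ M) = 1"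
proof -
  obtain K where K: "\<zeta> ^ (p ^ K) = 1"
    using assms by (auto simp: Tp_def)
  have "\<zeta> ^ (p ^ M) = 1" if "M \<ge> K" for M
  proof -
    have "p ^ M = p ^ K * p ^ (M - K)"
      using that by (simp flip: power_add)
    then show ?thesis
      by (simp add: power_mult K)
  qed
  then show ?thesis
    by (auto simp: eventually_sequentially)
qed

context padic_absv
begin

lemma p_pos [simp]: "p > 0" and p_nonzero [simp]: "p \<noteq> 0"
  using p_gt_1 by simp_all

lemma convergent_p_power_power: "convergent (\<lambda>M. (of_nat p ^ M :: 'a) ^ j)"
  using tendsto_power_strong[OF p_power_tendsto_0 tendsto_const, of j] by (rule convergentI)

text \<open>The moments are determined recursively by telescoping \<open>y ^ (j + 1)\<close> if \<open>\<zeta> = 1\<close>, and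
  \<open>\<zeta> ^ y * y ^ j\<close> otherwise.\<close>

lemma convergent_twisted_moment:
  fixes \<zeta> :: 'a
  assumes "\<zeta> \<in> Tp p"
  shows "convergent (\<lambda>M. (\<Sum>y<p ^ M. \<zeta> ^ y * of_nat y ^ j) / of_nat p ^ M)"
proof (induction j rule: less_induct)
  case (less j)
  define S where "S = (\<lambda>i M. \<Sum>y<p ^ M. \<zeta> ^ y * of_nat y ^ i :: 'a)"
  have IH: "convergent (\<lambda>M. S i M / of_nat p ^ M)" if "i < j" for i
    using less[OF that] by (simp add: S_def)
  have Suc_power: "of_nat (Suc y) ^ k = (\<Sum>i<k. of_nat (k choose i) * of_nat y ^ i) + (of_nat y ^ k :: 'a)" for y k
    using binomial_ring[of "of_nat y :: 'a" 1 k] by (simp add: add.commute lessThan_Suc_atMost[symmetric])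
  have "convergent (\<lambda>M. S j M / of_nat p ^ M)"
  proof (cases "\<zeta> = 1")
    case True
    have "S j M / of_nat p ^ M = 1 / of_nat (Suc j) *
        ((of_nat p ^ M) ^ j - (\<Sum>i<j. of_nat (Suc j choose i) * (S i M / of_nat p ^ M)))" for M
    proof -
      have "(of_nat p ^ M) ^ Suc j = (\<Sum>y<p ^ M. of_nat (Suc y) ^ Suc j - (of_nat y :: 'a) ^ Suc j)"
        by (subst sum_lessThan_telescope) simp
      also have "\<dots> = (\<Sum>y<p ^ M. \<Sum>i<Suc j. of_nat (Suc j choose i) * of_nat y ^ i)"
        by (subst Suc_power) simp
      also have "\<dots> = (\<Sum>i<Suc j. of_nat (Suc j choose i) * S i M)"
        by (subst sum.swap) (simp add: S_def True sum_distrib_left)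
      also have "\<dots> = of_nat (Suc j) * S j M + (\<Sum>i<j. of_nat (Suc j choose i) * S i M)"
        by (simp del: of_nat_Suc binomial_Suc_Suc)
      finally have eq: "of_nat (Suc j) * S j M = (of_nat p ^ M) ^ Suc j - (\<Sum>i<j. of_nat (Suc j choose i) * S i M)"
        by simp
      have "(of_nat p ^ M) ^ j - (\<Sum>i<j. of_nat (Suc j choose i) * (S i M / of_nat p ^ M))
          = (of_nat (Suc j) * S j M) / of_nat p ^ M"
        unfolding eq by (simp add: diff_divide_distrib sum_divide_distrib del: of_nat_Suc)
      then show ?thesis
        by (simp del: of_nat_Suc)
    qed
    moreover have "convergent (\<lambda>M. 1 / of_nat (Suc j) *
        ((of_nat p ^ M) ^ j - (\<Sum>i<j. of_nat (Suc j choose i) * (S i M / of_nat p ^ M))))"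
      unfolding diff_conv_add_uminus sum_negf[symmetric] mult_minus_left[symmetric]
      by (intro convergent_const_mult convergent_add convergent_p_power_power convergent_sum_nonarch IH) simp
    ultimately show ?thesis
      by simp
  next
    case False
    have "S j M / of_nat p ^ M = 1 / (\<zeta> - 1) *
        ((\<zeta> ^ (p ^ M) * (of_nat p ^ M) ^ j - 0 ^ j) / of_nat p ^ M
          - (\<Sum>i<j. \<zeta> * of_nat (j choose i) * (S i M / of_nat p ^ M)))" for M
    proof -
      have "\<zeta> ^ (p ^ M) * (of_nat p ^ M) ^ j - 0 ^ j
          = (\<Sum>y<p ^ M. \<zeta> ^ Suc y * of_nat (Suc y) ^ j - \<zeta> ^ y * of_nat y ^ j)"
        by (subst sum_lessThan_telescope) simp
      also have "\<dots> = (\<Sum>y<p ^ M. (\<zeta> - 1) * (\<zeta> ^ y * of_nat y ^ j)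
          + (\<Sum>i<j. \<zeta> * of_nat (j choose i) * (\<zeta> ^ y * of_nat y ^ i)))"
        by (subst Suc_power) (simp add: algebra_simps sum_distrib_left)
      also have "\<dots> = (\<zeta> - 1) * S j M + (\<Sum>i<j. \<zeta> * of_nat (j choose i) * S i M)"
        by (simp add: sum.distrib sum_distrib_left S_def sum.swap[of _ "{..<j}"])
      finally have eq: "(\<zeta> - 1) * S j M
          = (\<zeta> ^ (p ^ M) * (of_nat p ^ M) ^ j - 0 ^ j) - (\<Sum>i<j. \<zeta> * of_nat (j choose i) * S i M)"
        by simp
      have "(\<zeta> ^ (p ^ M) * (of_nat p ^ M) ^ j - 0 ^ j) / of_nat p ^ M
          - (\<Sum>i<j. \<zeta> * of_nat (j choose i) * (S i M / of_nat p ^ M)) = ((\<zeta> - 1) * S j M) / of_nat p ^ M"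
        unfolding eq by (simp add: diff_divide_distrib sum_divide_distrib)
      then show ?thesis
        using False by simp
    qed
    \<comment> \<open>The boundary term of the telescoping, with \<open>0 ^ j = 1\<close> for
      \<open>j = 0\<close>. Once \<open>\<zeta> ^ (p ^ M) = 1\<close>, it is 0 for
      \<open>j = 0\<close> and \<open>(p ^ M) ^ (j - 1)\<close> otherwise.\<close>
    moreover have "convergent (\<lambda>M. (\<zeta> ^ (p ^ M) * (of_nat p ^ M) ^ j - 0 ^ j) / of_nat p ^ M)"
    proof (cases j)
      case 0
      have "convergent (\<lambda>M. 0 :: 'a)"
        by (rule convergent_const)
      then show ?thesis
        by (rule iffD1[OF convergent_cong, rotated]) (use Tp_eventually[OF assms] 0 in \<open>auto elim!: eventually_mono\<close>)
    next
      case (Suc i)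
      then show ?thesis
        by (intro iffD1[OF convergent_cong convergent_p_power_power[of i]])
          (use Tp_eventually[OF assms] in \<open>auto elim!: eventually_mono\<close>)
    qed
    then have "convergent (\<lambda>M. 1 / (\<zeta> - 1) *
        ((\<zeta> ^ (p ^ M) * (of_nat p ^ M) ^ j - 0 ^ j) / of_nat p ^ M
          - (\<Sum>i<j. \<zeta> * of_nat (j choose i) * (S i M / of_nat p ^ M))))"
      unfolding diff_conv_add_uminus[of _ "sum _ _"] sum_negf[symmetric] mult_minus_left[symmetric]
      by (intro convergent_const_mult convergent_add convergent_sum_nonarch IH) simp_all
    ultimately show ?thesis
      by simp
  qed
  then show ?case
    by (simp add: S_def)
qed

text \<open>If \<open>\<zeta> * s = 1\<close>, the average is constantly 1. Otherwise, once
  \<open>\<zeta> ^ (p ^ M) = 1\<close>, the geometric sum is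
  \<open>(s ^ (p ^ M) - 1) / (\<zeta> * s - 1)\<close>, so the average tends to a multiple of
  \<open>padic_log s\<close>.\<close>

lemma convergent_geometric_average:
  fixes \<zeta> s :: 'a
  assumes "\<zeta> \<in> Tp p" and s: "absv (s - 1) < 1"
  shows "convergent (\<lambda>M. (\<Sum>y<p ^ M. (\<zeta> * s) ^ y) / of_nat p ^ M)"
proof (cases "\<zeta> * s = 1")
  case True
  then show ?thesis
    by (simp add: convergent_const)
next
  case False
  have "convergent (\<lambda>M. 1 / (\<zeta> * s - 1) * ((s ^ (p ^ M) - 1) / of_nat p ^ M))"
    using p_power_tendsto_padic_log[OF s] by (intro convergent_const_mult convergentI)
  moreover have "\<forall>\<^sub>F M in sequentially. 1 / (\<zeta> * s - 1) * ((s ^ (p ^ M) - 1) / of_nat p ^ M)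
      = (\<Sum>y<p ^ M. (\<zeta> * s) ^ y) / of_nat p ^ M"
    using Tp_eventually[OF assms(1)]
  proof eventually_elim
    case (elim M)
    then have "(\<Sum>y<p ^ M. (\<zeta> * s) ^ y) = (s ^ (p ^ M) - 1) / (\<zeta> * s - 1)"
      unfolding geometric_sum[OF False] by (simp add: power_mult_distrib)
    then show ?case
      by simp
  qed
  ultimately show ?thesis
    by (rule iffD1[OF convergent_cong, rotated])
qed

section \<open>Averages of the integrand for a fixed \<open>q\<close>\<close>

context
  fixes q :: 'a
  assumes q: "absv (q - 1) < rad"
begin

lemma q_less_1: "absv (q - 1) < 1"
  using q rad_less_1 by simp

lemma q_nonzero: "q \<noteq> 0"
  using absv_eq_1[OF q_less_1] by auto

lemma absv_q_power_minus_1: "absv (q ^ m - 1) < rad"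
  using absv_power_minus_1_le[OF q_less_1] q by (rule le_less_trans)

lemma q_power_eq_1_iff: "m > 0 \<Longrightarrow> q ^ m = 1 \<longleftrightarrow> q = 1"
  using power_eq_1_imp_eq_1[OF q] by auto

lemma qpow_of_nat: "qpow q (of_nat k) = q ^ k"
  using qpow_of_int[OF q, of "int k"] by simp

lemma qnum_of_nat: "qnum (of_nat k) q = qcount q k"
  by (simp add: qnum_def qpow_of_nat qcount_eq_divide)

lemma qquot_of_nat: "qquot q (of_nat x) m = qcount q x / qcount q m"
  by (simp add: qquot_def qpow_of_nat qcount_eq_divide)

lemma qcount_nonzero: "m > 0 \<Longrightarrow> qcount q m \<noteq> 0"
  using q_power_eq_1_iff[of m] by (cases "q = 1") (simp_all add: qcount_eq_divide)

text \<open>It lets \<open>qcount q (m * p ^ M)\<close> replace \<open>p ^ M\<close> as the divisor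
  of an average. The limit is \<open>m\<close> for \<open>q = 1\<close> and
  \<open>padic_log (q ^ m) / (q - 1)\<close> otherwise; that logarithm is nonzero because
  \<open>padic_exp\<close> takes it back to \<open>q ^ m \<noteq> 1\<close>.\<close>

lemma qcount_p_power_tendsto:
  assumes "m > 0"
  obtains c where "(\<lambda>M. qcount q (m * p ^ M) / of_nat p ^ M) \<longlonglongrightarrow> c" "c \<noteq> 0"
proof (cases "q = 1")
  case True
  then show ?thesis
    using assms by (intro that[of "of_nat m"]) auto
next
  case False
  have m: "absv (q ^ m - 1) < 1"
    using absv_q_power_minus_1 rad_less_1 by (rule less_trans)
  have "qcount q (m * p ^ M) / of_nat p ^ M = ((q ^ m) ^ (p ^ M) - 1) / of_nat p ^ M / (q - 1)" for M
    using minus_divide_divide[of "(q ^ m) ^ (p ^ M) - 1" "q - 1"] False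
    by (simp add: qcount_eq_divide power_mult mult.commute)
  moreover have "(\<lambda>M. ((q ^ m) ^ (p ^ M) - 1) / of_nat p ^ M / (q - 1)) \<longlonglongrightarrow> padic_log (q ^ m) / (q - 1)"
    using False by (intro tendsto_divide_nonarch p_power_tendsto_padic_log m tendsto_const) auto
  moreover have "padic_log (q ^ m) \<noteq> 0"
    using padic_exp_log[OF absv_q_power_minus_1, of m] q_power_eq_1_iff[OF assms] False by auto
  ultimately show ?thesis
    using False by (intro that[of "padic_log (q ^ m) / (q - 1)"]) simp_all
qed

lemma convergent_q_integrand_average:
  assumes \<xi>: "\<xi> \<in> Tp p"
  shows "convergent (\<lambda>M. (\<Sum>y<p ^ M. q_integrand h n \<xi> q (a + m * y)) / of_nat p ^ M)"
proof (cases "q = 1")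
  case True
  \<comment> \<open>Expanding \<open>(a + m * y) ^ n\<close> leaves the moments twisted by
    \<open>\<zeta> = \<xi> ^ m\<close>; everything independent of \<open>y\<close> goes into
    \<open>c k\<close>.\<close>
  define c where "c = (\<lambda>k. \<xi> ^ a * of_nat (n choose k) * of_nat a ^ (n - k) * of_nat m ^ k :: 'a)"
  have "q_integrand h n \<xi> q (a + m * y) = (\<Sum>k\<le>n. c k * ((\<xi> ^ m) ^ y * of_nat y ^ k))" for y
  proof -
    have "(of_nat m * of_nat y + of_nat a :: 'a) ^ n
        = (\<Sum>k\<le>n. of_nat (n choose k) * (of_nat m * of_nat y) ^ k * of_nat a ^ (n - k))"
      by (rule binomial_ring)
    then show ?thesis
      by (simp add: q_integrand_def True c_def power_add power_mult power_mult_distrib sum_distrib_left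
          mult_ac add.commute)
  qed
  then have "(\<Sum>y<p ^ M. q_integrand h n \<xi> q (a + m * y)) / of_nat p ^ M
      = (\<Sum>k\<le>n. c k * ((\<Sum>y<p ^ M. (\<xi> ^ m) ^ y * of_nat y ^ k) / of_nat p ^ M))" for M
    by (simp add: sum.swap[of _ "{..<p ^ M}"] sum_distrib_left sum_divide_distrib)
  then show ?thesis
    by (simp only:) (intro convergent_sum_nonarch convergent_const_mult convergent_twisted_moment Tp_power \<xi>)
next
  case False
  \<comment> \<open>Expanding \<open>(1 - q ^ x) ^ n\<close> makes the integrand a combination of
    exponentials \<open>(\<xi> * s k) ^ x\<close>. At \<open>x = a + m * y\<close> the part coming
    from \<open>a\<close> goes into \<open>c k\<close>. The exponent \<open>h + k\<close> may be
    negative.\<close>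
  define s where "s = (\<lambda>k. q powi (h + int k))"
  define c where "c = (\<lambda>k. of_nat (n choose k) * (- 1) ^ k / (1 - q) ^ n * (\<xi> * s k) ^ a)"
  have s: "absv (s k ^ m - 1) < 1" for k
  proof -
    have "absv (s k - 1) < 1"
      unfolding s_def using absv_power_int_minus_1_le[OF q_less_1] q_less_1 by (rule le_less_trans)
    then show ?thesis
      using absv_power_minus_1_le by (meson le_less_trans)
  qed
  have s_power: "s k ^ x = q powi (h * int x) * (q ^ x) ^ k" for k x
  proof -
    have "s k ^ x = q powi ((h + int k) * int x)"
      by (simp add: s_def power_int_mult)
    also have "\<dots> = q powi (h * int x) * q powi (int (x * k))"
      using q_nonzero by (simp add: power_int_add[symmetric] algebra_simps)
    finally show ?thesis
      by (simp only: power_int_of_nat power_mult)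
  qed
  have "q_integrand h n \<xi> q (a + m * y) = (\<Sum>k\<le>n. c k * (\<xi> ^ m * s k ^ m) ^ y)" for y
  proof -
    define x where "x = a + m * y"
    have "qcount q x ^ n = (1 - q ^ x) ^ n / (1 - q) ^ n"
      using False by (simp add: qcount_eq_divide power_divide)
    also have "(1 - q ^ x) ^ n = (\<Sum>k\<le>n. of_nat (n choose k) * (- 1) ^ k * (q ^ x) ^ k)"
      using binomial_ring[of "- (q ^ x)" 1 n] by (simp add: power_minus[of "q ^ x"] mult.assoc)
    finally have "q_integrand h n \<xi> q x
        = (\<Sum>k\<le>n. of_nat (n choose k) * (- 1) ^ k / (1 - q) ^ n * (\<xi> * s k) ^ x)"
      by (simp add: q_integrand_def sum_divide_distrib sum_distrib_left power_mult_distrib s_power mult_ac)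
    also have "\<dots> = (\<Sum>k\<le>n. c k * (\<xi> ^ m * s k ^ m) ^ y)"
      by (simp add: x_def c_def power_add power_mult power_mult_distrib mult_ac)
    finally show ?thesis
      by (simp add: x_def)
  qed
  then have "(\<Sum>y<p ^ M. q_integrand h n \<xi> q (a + m * y)) / of_nat p ^ M
      = (\<Sum>k\<le>n. c k * ((\<Sum>y<p ^ M. (\<xi> ^ m * s k ^ m) ^ y) / of_nat p ^ M))" for M
    by (simp add: sum.swap[of _ "{..<p ^ M}"] sum_distrib_left sum_divide_distrib)
  then show ?thesis
    by (simp only:) (intro convergent_sum_nonarch convergent_const_mult convergent_geometric_average Tp_power \<xi> s)
qed

lemma convergent_q_integrand:
  assumes "\<xi> \<in> Tp p" "m > 0"
  shows "convergent (\<lambda>M. (\<Sum>y<p ^ M. q_integrand h n \<xi> q (a + m * y)) / qcount q (m * p ^ M))"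
proof -
  obtain L where L: "(\<lambda>M. (\<Sum>y<p ^ M. q_integrand h n \<xi> q (a + m * y)) / of_nat p ^ M) \<longlonglongrightarrow> L"
    using convergent_q_integrand_average[OF assms(1)] unfolding convergent_def by blast
  obtain c where c: "(\<lambda>M. qcount q (m * p ^ M) / of_nat p ^ M) \<longlonglongrightarrow> c" "c \<noteq> 0"
    using qcount_p_power_tendsto[OF assms(2)] .
  have "(\<lambda>M. (\<Sum>y<p ^ M. q_integrand h n \<xi> q (a + m * y)) / of_nat p ^ M
      / (qcount q (m * p ^ M) / of_nat p ^ M)) \<longlonglongrightarrow> L / c"
    by (intro tendsto_divide_nonarch L c)
  then show ?thesis
    by (intro convergentI) simp
qed

end

end

section \<open>Compact open subsets of the inverse limit\<close>

text \<open>The canonical image of an integer in the inverse limit; the images of natural numbers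
  are the sample points of \<open>partial_measure\<close>.\<close>

definition residues_of :: "nat \<Rightarrow> nat \<Rightarrow> int \<Rightarrow> nat \<Rightarrow> int" where
  "residues_of l p a = (\<lambda>N. a mod int (l * p ^ N))"

context
  fixes l p :: nat
  assumes l: "l > 0" and p: "p > 0"
begin

lemma residues_of_in_XX: "residues_of l p a \<in> XX l p"
  using l p by (auto simp: residues_of_def XX_def cong_def mod_mod_cancel)

text \<open>Since a coordinate determines all earlier ones, agreement of two points at level
  \<open>N\<close> means agreement at every level up to \<open>N\<close>.\<close>

lemma XX_nth_mod:
  assumes "x \<in> XX l p" "N \<le> M"
  shows "x N = x M mod int (l * p ^ N)"
  using assms(2)
proof (induction M rule: dec_induct)
  case base
  then show ?case
    using assms(1) by (simp add: XX_def)
next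
  case (step M)
  have "int (l * p ^ N) dvd int (l * p ^ M)"
    using step by (auto simp: le_imp_power_dvd)
  moreover have "[x (Suc M) = x M] (mod int (l * p ^ M))"
    using assms(1) by (simp add: XX_def)
  ultimately have "[x (Suc M) = x M] (mod int (l * p ^ N))"
    by (rule cong_dvd_modulus[rotated])
  then show ?case
    using step by (simp add: cong_def)
qed

lemma Xball_eq:
  assumes "a \<in> {0..<int (l * p ^ N)}"
  shows "Xball l p a N = {x \<in> XX l p. x N = a}"
  using assms by (auto simp: Xball_def XX_def cong_def)

lemma residues_of_in_Xball_iff:
  assumes "a < l * p ^ N"
  shows "residues_of l p (int x) \<in> Xball l p (int a) N \<longleftrightarrow> x mod (l * p ^ N) = a"
proof -
  have "residues_of l p (int x) N = int (x mod (l * p ^ N))"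
    by (simp only: residues_of_def zmod_int)
  moreover have "int a \<in> {0..<int (l * p ^ N)}"
    using assms by (simp only: atLeastLessThan_iff of_nat_less_iff of_nat_0_le_iff simp_thms)
  ultimately show ?thesis
    using residues_of_in_XX[of "int x"] by (simp only: Xball_eq mem_Collect_eq of_nat_eq_iff simp_thms)
qed

text \<open>The set is closed in a product of finite sets, which is compact by Tychonoff: the
  compatibility conditions are equations between continuous functions.\<close>

lemma compact_XX: "compact (XX l p)"
proof -
  let ?P = "\<Pi>\<^sub>E N\<in>UNIV. {0..<int (l * p ^ N)}"
  have "compactin (product_topology (\<lambda>N. euclidean) UNIV) ?P"
    by (subst compactin_PiE) (auto intro: finite_imp_compact)
  then have "compact ?P"
    by (simp add: euclidean_product_topology)
  moreover have "closed (\<Inter>N. {x::nat \<Rightarrow> int. x (Suc N) mod int (l * p ^ N) = x N mod int (l * p ^ N)})"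
    by (intro closed_INT ballI closed_Collect_eq
        continuous_on_compose2[of UNIV "\<lambda>k::int. k mod _", OF _ continuous_on_product_coordinates]) auto
  moreover have "XX l p = ?P \<inter> (\<Inter>N. {x. x (Suc N) mod int (l * p ^ N) = x N mod int (l * p ^ N)})"
    by (auto simp: XX_def cong_def PiE_def Pi_def)
  ultimately show ?thesis
    by (simp add: compact_Int_closed)
qed

lemma openin_XX_vimage: "openin (top_of_set (XX l p)) {x \<in> XX l p. x N \<in> A}"
proof -
  have "open ((\<lambda>x::nat \<Rightarrow> int. x N) -` A)"
    by (intro open_vimage open_discrete continuous_on_product_coordinates)
  then show ?thesis
    unfolding openin_open by (intro exI[of _ "(\<lambda>x. x N) -` A"]) auto
qed

lemma Xball_compact_open:
  assumes "a \<in> {0..<int (l * p ^ N)}"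
  shows "Xball l p a N \<in> compact_opens (XX l p)"
proof -
  have "closed ((\<lambda>x::nat \<Rightarrow> int. x N) -` {a})"
    by (intro closed_vimage closed_singleton continuous_on_product_coordinates)
  then have "compact (XX l p \<inter> (\<lambda>x. x N) -` {a})"
    using compact_XX by (rule compact_Int_closed[rotated])
  moreover have "XX l p \<inter> (\<lambda>x. x N) -` {a} = Xball l p a N"
    using Xball_eq[OF assms] by auto
  ultimately show ?thesis
    using openin_XX_vimage[of N "{a}"] Xball_eq[OF assms] by (simp add: compact_opens_def)
qed

lemma openin_XX_contains_ball:
  assumes "openin (top_of_set (XX l p)) U" "x \<in> U"
  shows "\<exists>N. {y \<in> XX l p. y N = x N} \<subseteq> U"
proof -
  obtain V where V: "open V" "U = XX l p \<inter> V"
    using assms(1) by (auto simp: openin_open)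
  have "openin (product_topology (\<lambda>N. euclidean) UNIV) V"
    using V(1) by (simp add: euclidean_product_topology)
  then obtain W where W: "finite {i. W i \<noteq> (UNIV :: int set)}" "x \<in> Pi\<^sub>E UNIV W" "Pi\<^sub>E UNIV W \<subseteq> V"
    using assms(2) V(2) unfolding openin_product_topology_alt by fastforce
  \<comment> \<open>A basic open box restricts finitely many coordinates, and \<open>N\<close>
    bounds their indices. The inserted 0 gives the maximum a value when no coordinate is
    restricted.\<close>
  define N where "N = Max (insert 0 {i. W i \<noteq> (UNIV :: int set)})"
  have N: "i \<le> N" if "W i \<noteq> UNIV" for i
    using that W(1) by (auto simp: N_def)
  have "{y \<in> XX l p. y N = x N} \<subseteq> U"
  proof (intro subsetI, clarify)
    fix y assume y: "y \<in> XX l p" "y N = x N"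
    have x: "x \<in> XX l p"
      using assms(2) V(2) by auto
    have "y i \<in> W i" for i
    proof (cases "W i = UNIV")
      case False
      then have "y i = x i"
        using XX_nth_mod[OF y(1) N] XX_nth_mod[OF x N] y(2) by metis
      then show ?thesis
        using W(2) by auto
    qed auto
    then show "y \<in> U"
      using W(3) y(1) V(2) by auto
  qed
  then show ?thesis ..
qed

text \<open>Compactness makes the level from \<open>openin_XX_contains_ball\<close> uniform:
  finitely many balls cover \<open>U\<close>, and the largest of their levels serves for all
  points.\<close>

lemma compact_open_level:
  assumes U: "U \<in> compact_opens (XX l p)"
  obtains N where "N > 0" "\<And>x y. x \<in> U \<Longrightarrow> y \<in> XX l p \<Longrightarrow> y N = x N \<Longrightarrow> y \<in> U"
proof -
  have op: "openin (top_of_set (XX l p)) U" and "compact U"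
    using U by (auto simp: compact_opens_def)
  then have sub: "U \<subseteq> XX l p"
    using openin_imp_subset by blast
  have "\<forall>x\<in>U. \<exists>N. {y \<in> XX l p. y N = x N} \<subseteq> U"
    using openin_XX_contains_ball[OF op] by blast
  then obtain n where n: "\<And>x. x \<in> U \<Longrightarrow> {y \<in> XX l p. y (n x) = x (n x)} \<subseteq> U"
    by metis
  have "U \<subseteq> (\<Union>x\<in>U. (\<lambda>y. y (n x)) -` {x (n x)})"
    by auto
  then obtain D where D: "D \<subseteq> U" "finite D" "U \<subseteq> (\<Union>x\<in>D. (\<lambda>y. y (n x)) -` {x (n x)})"
    by (rule compactE_image[OF \<open>compact U\<close>, rotated])
      (assumption | intro open_vimage open_discrete continuous_on_product_coordinates)+
  \<comment> \<open>The inserted 1 covers an empty \<open>D\<close> and forces \<open>N > 0\<close>,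
    the range in which values on balls are prescribed.\<close>
  define N where "N = Max (insert 1 (n ` D))"
  have N: "n x \<le> N" if "x \<in> D" for x
    using that D(2) by (auto simp: N_def)
  show thesis
  proof (rule that)
    have "1 \<le> N"
      using D(2) by (auto simp: N_def)
    then show "N > 0"
      by simp
    fix x y assume x: "x \<in> U" and y: "y \<in> XX l p" "y N = x N"
    obtain z where z: "z \<in> D" "x (n z) = z (n z)"
      using x D(3) by auto
    have "x \<in> XX l p"
      using x sub by auto
    then have "y (n z) = x (n z)"
      using XX_nth_mod[OF _ N[OF z(1)]] y by metis
    then show "y \<in> U"
      using n[of z] z D(1) y by auto
  qed
qed

lemma compact_open_decomposition:
  assumes U: "U \<in> compact_opens (XX l p)"
  obtains N A where "N > 0" "A \<subseteq> {0..<int (l * p ^ N)}" "U = (\<Union>a\<in>A. Xball l p a N)"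
proof -
  obtain N where N: "N > 0" "\<And>x y. x \<in> U \<Longrightarrow> y \<in> XX l p \<Longrightarrow> y N = x N \<Longrightarrow> y \<in> U"
    using compact_open_level[OF U] by metis
  have sub: "U \<subseteq> XX l p"
    using U openin_imp_subset by (auto simp: compact_opens_def)
  have A: "(\<lambda>x. x N) ` U \<subseteq> {0..<int (l * p ^ N)}"
    using sub by (auto simp: XX_def)
  have "(\<Union>a\<in>(\<lambda>x. x N) ` U. Xball l p a N) = (\<Union>a\<in>(\<lambda>x. x N) ` U. {x \<in> XX l p. x N = a})"
    using A by (intro SUP_cong refl Xball_eq) blast
  also have "\<dots> = U"
    using N(2) sub by auto
  finally show thesis
    using that[OF N(1) A] by simp
qed

lemma disjoint_Xballs:
  assumes "A \<subseteq> {0..<int (l * p ^ N)}"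
  shows "disjoint ((\<lambda>a. Xball l p a N) ` A)"
proof (rule disjointI)
  fix B C assume "B \<in> (\<lambda>a. Xball l p a N) ` A" "C \<in> (\<lambda>a. Xball l p a N) ` A" "B \<noteq> C"
  then obtain a b where ab: "a \<in> A" "b \<in> A" "B = Xball l p a N" "C = Xball l p b N" "a \<noteq> b"
    by auto
  then have "B = {x \<in> XX l p. x N = a}" "C = {x \<in> XX l p. x N = b}"
    using Xball_eq[OF subsetD[OF assms]] by simp_all
  then show "B \<inter> C = {}"
    using \<open>a \<noteq> b\<close> by auto
qed

text \<open>Additivity fixes the value on a compact open set, a finite disjoint union of balls of
  one level \<open>N > 0\<close>; elsewhere both functions have the dummy value.\<close>

lemma distributions_eqI:
  fixes \<nu> \<nu>' :: "(nat \<Rightarrow> int) set \<Rightarrow> 'b::comm_monoid_add"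
  assumes \<nu>: "\<nu> \<in> distributions (XX l p)" and \<nu>': "\<nu>' \<in> distributions (XX l p)"
    and eq: "\<And>N a. N > 0 \<Longrightarrow> a \<in> {0..<int (l * p ^ N)} \<Longrightarrow> \<nu> (Xball l p a N) = \<nu>' (Xball l p a N)"
  shows "\<nu> = \<nu>'"
proof (rule extensionalityI)
  show "\<nu> \<in> extensional (compact_opens (XX l p))" "\<nu>' \<in> extensional (compact_opens (XX l p))"
    using \<nu> \<nu>' by (auto simp: distributions_def PiE_def)
  fix U assume "U \<in> compact_opens (XX l p)"
  then obtain N A where N: "N > 0" and A: "A \<subseteq> {0..<int (l * p ^ N)}" and U: "U = \<Union>((\<lambda>a. Xball l p a N) ` A)"
    by (rule compact_open_decomposition)
  let ?B = "(\<lambda>a. Xball l p a N) ` A"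
  have "finite ?B \<and> ?B \<subseteq> compact_opens (XX l p) \<and> disjoint ?B"
    using A disjoint_Xballs[OF A] finite_subset[OF A] by (auto intro!: Xball_compact_open)
  then have "\<nu> U = (\<Sum>B\<in>?B. \<nu> B)" "\<nu>' U = (\<Sum>B\<in>?B. \<nu>' B)"
    using \<nu> \<nu>' unfolding U distributions_def by blast+
  moreover have "(\<Sum>B\<in>?B. \<nu> B) = (\<Sum>B\<in>?B. \<nu>' B)"
    using A eq[OF N] by (intro sum.cong) auto
  ultimately show "\<nu> U = \<nu>' U"
    by simp
qed

end

section \<open>Powers of roots of unity with p-adic exponents\<close>

context padic_absv
begin

text \<open>It turns p-adic closeness of natural numbers into a congruence: an absolute value below
  1 forces a factor \<open>p\<close>, which is cancelled before the next step.\<close>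

lemma p_power_dvd_if_absv_le:
  "absv (of_nat d :: 'a) \<le> 1 / real p ^ K \<Longrightarrow> p ^ K dvd d"
proof (induction K arbitrary: d)
  case (Suc K)
  have "1 / real p ^ Suc K < 1"
    using p_gt_1 by (simp add: divide_less_eq_1 one_less_power del: power_Suc)
  then have "p dvd d"
    using absv_of_nat_coprime[of d] Suc.prems by fastforce
  then obtain e where e: "d = p * e" ..
  have "absv (of_nat e :: 'a) \<le> 1 / real p ^ K"
    using Suc.prems p_gt_1 by (simp add: e absv_mult absv_p field_simps)
  then show ?case
    using Suc.IH by (simp add: e)
qed auto

text \<open>If \<open>\<zeta> ^ (p ^ K) = 1\<close>, then \<open>\<zeta> ^ k\<close> depends only on
  \<open>k\<close> modulo \<open>p ^ K\<close>, so it is constant for \<open>k\<close> p-adically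
  close to \<open>y\<close>.\<close>

lemma rootpow_of_nat:
  fixes \<zeta> :: 'a
  assumes "\<zeta> \<in> Tp p"
  shows "rootpow \<zeta> (of_nat y) = \<zeta> ^ y"
proof -
  obtain K where K: "\<zeta> ^ (p ^ K) = 1"
    using assms by (auto simp: Tp_def)
  have dvd: "\<zeta> ^ (a + d) = \<zeta> ^ a" if "absv (of_nat d :: 'a) \<le> 1 / real p ^ K" for a d
    using p_power_dvd_if_absv_le[OF that] K by (auto simp: power_add power_mult elim!: dvdE)
  have near: "\<zeta> ^ k = \<zeta> ^ y" if "absv (of_nat k - of_nat y :: 'a) \<le> 1 / real p ^ K" for k
  proof (cases "y \<le> k")
    case True
    then show ?thesis
      using dvd[of "k - y" y] that by (simp add: of_nat_diff)
  next
    case False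
    then show ?thesis
      using dvd[of "y - k" k] that by (simp add: of_nat_diff absv_minus_commute)
  qed
  let ?F = "filtercomap of_nat (nhds (of_nat y :: 'a))"
  have "\<forall>\<^sub>F z in nhds (of_nat y :: 'a). dist z (of_nat y) < 1 / real p ^ K"
    using p_gt_1 unfolding eventually_nhds_metric by (intro exI[of _ "1 / real p ^ K"]) auto
  then have "\<forall>\<^sub>F k in ?F. dist (of_nat k) (of_nat y :: 'a) < 1 / real p ^ K"
    by (rule eventually_filtercomapI)
  then have "\<forall>\<^sub>F k in ?F. \<zeta> ^ k = \<zeta> ^ y"
    by eventually_elim (auto intro!: near simp: dist_absv)
  then have "((\<lambda>k. \<zeta> ^ k) \<longlongrightarrow> \<zeta> ^ y) ?F"
    by (rule tendsto_eventually)
  \<comment> \<open>The number \<open>y\<close> itself lies in the preimage of every neighbourhood.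
    A nontrivial filter is what makes \<open>Lim\<close> well determined.\<close>
  moreover have "?F \<noteq> bot"
    by (rule filtercomap_neq_bot) (auto dest!: eventually_nhds_x_imp_x)
  ultimately show ?thesis
    unfolding rootpow_def by (intro tendsto_Lim)
qed

end

section \<open>The distribution\<close>

text \<open>A Riemann sum of level \<open>M\<close> with mass \<open>F x / [l * p ^ M; q]\<close> at
  each \<open>x < l * p ^ M\<close>. Being defined for every set \<open>U\<close>, it is additive
  before any limit is taken.\<close>

definition partial_measure ::
  "nat \<Rightarrow> nat \<Rightarrow> 'a::field \<Rightarrow> (nat \<Rightarrow> 'a) \<Rightarrow> nat \<Rightarrow> (nat \<Rightarrow> int) set \<Rightarrow> 'a" where
  "partial_measure l p q F M U =
     (\<Sum>x<l * p ^ M. if residues_of l p (int x) \<in> U then F x else 0) / qcount q (l * p ^ M)"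

lemma partial_measure_Union:
  assumes "finite \<U>" "disjoint \<U>"
  shows "partial_measure l p q F M (\<Union>\<U>) = (\<Sum>U\<in>\<U>. partial_measure l p q F M U)"
proof -
  have "(if x \<in> \<Union>\<U> then c else 0) = (\<Sum>U\<in>\<U>. if x \<in> U then c else (0::'a))" for x c
  proof (cases "x \<in> \<Union>\<U>")
    case True
    then obtain V where V: "V \<in> \<U>" "x \<in> V"
      by auto
    then have "(\<Sum>U\<in>\<U>. if x \<in> U then c else 0) = (\<Sum>U\<in>\<U>. if U = V then c else 0)"
      using assms(2) by (intro sum.cong) (auto simp: disjoint_def)
    then show ?thesis
      using V assms(1) by auto
  qed (auto intro!: sum.neutral)
  then show ?thesis
    by (simp only: partial_measure_def sum_divide_distrib[symmetric] sum.swap[of _ \<U>])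
qed

lemma sum_residue_class:
  fixes F :: "nat \<Rightarrow> 'b::comm_monoid_add"
  assumes "a < m"
  shows "(\<Sum>x<m * k. if x mod m = a then F x else 0) = (\<Sum>y<k. F (a + m * y))"
proof -
  have "(\<Sum>x<m * k. if x mod m = a then F x else 0) = (\<Sum>x\<in>{x\<in>{..<m * k}. x mod m = a}. F x)"
    by (rule sum.inter_filter[symmetric]) simp
  also have "\<dots> = (\<Sum>y<k. F (a + m * y))"
  proof (rule sum.reindex_bij_witness[where i = "\<lambda>y. a + m * y" and j = "\<lambda>x. x div m"])
    fix y assume "y \<in> {..<k}"
    then have "m * Suc y \<le> m * k"
      by (intro mult_le_mono2) simp
    then show "a + m * y \<in> {x \<in> {..<m * k}. x mod m = a}"
      using assms by simp
  next
    fix x assume "x \<in> {x \<in> {..<m * k}. x mod m = a}"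
    then show "x div m \<in> {..<k}" "a + m * (x div m) = x" "F (a + m * (x div m)) = F x"
      using assms by (auto simp: less_mult_imp_div_less mult.commute)
  qed (use assms in auto)
  finally show ?thesis .
qed

text \<open>A ball of level \<open>N\<close> contains exactly \<open>p ^ M\<close> of the numbers
  below \<open>l * p ^ (M + N)\<close>; hence the index shift by \<open>N\<close>.\<close>

lemma partial_measure_Xball:
  assumes "l > 0" "p > 0" "a < l * p ^ N"
  shows "partial_measure l p q F (M + N) (Xball l p (int a) N) =
    (\<Sum>y<p ^ M. F (a + l * p ^ N * y)) / qcount q (l * p ^ N * p ^ M)"
proof -
  have "l * p ^ (M + N) = l * p ^ N * p ^ M"
    by (simp add: power_add)
  then show ?thesis
    using sum_residue_class[OF assms(3), of F "p ^ M"]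
    by (simp only: partial_measure_def residues_of_in_Xball_iff[OF assms])
qed

context padic_absv
begin

lemma partial_measure_Xball_tendsto:
  fixes q \<xi> :: 'a
  assumes q: "absv (q - 1) < rad" and \<xi>: "\<xi> \<in> Tp p" and l: "l > 0" and n: "n > 0"
    and a: "a \<in> {0..<int (l * p ^ N)}"
  shows "(\<lambda>M. partial_measure l p q (q_integrand h n \<xi> q) M (Xball l p a N)) \<longlonglongrightarrow>
    qnum (of_nat (l * p ^ N)) q ^ (n - 1) * qpow q (of_int (h * a)) * \<xi> powi a *
    q_bernoulli p h n (\<xi> ^ (l * p ^ N)) a (l * p ^ N) q"
proof -
  define m where "m = l * p ^ N"
  have m: "m > 0"
    using l by (simp add: m_def)
  obtain b where b: "a = int b" "b < m"
    using a by (metis atLeastLessThan_iff m_def nonneg_int_cases of_nat_less_iff)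
  \<comment> \<open>The prefactor of the prescribed value. As it is nonzero, the convergence of
    \<open>s = K * t\<close>, known from \<open>convergent_q_integrand\<close>, carries over to the
    sums \<open>t\<close> whose limit is \<open>q_bernoulli\<close>.\<close>
  define K where "K = qcount q m ^ (n - 1) * q powi (h * a) * \<xi> ^ b"
  define s where "s = (\<lambda>M. (\<Sum>y<p ^ M. q_integrand h n \<xi> q (b + m * y)) / qcount q (m * p ^ M))"
  define f where "f = (\<lambda>y. qpow q (of_nat m * of_int (h - 1) * y) * rootpow (\<xi> ^ m) y *
      qquot q (of_int a + of_nat m * y) m ^ n)"
  define t where "t = (\<lambda>M. 1 / qnum (of_nat (p ^ M)) (q ^ m) * (\<Sum>y<p ^ M. f (of_nat y) * (q ^ m) ^ y))"
  have K: "K \<noteq> 0"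
    using qcount_nonzero[OF q m] q_nonzero[OF q] Tp_nonzero[OF p_pos \<xi>] by (simp add: K_def)
  \<comment> \<open>The weight \<open>(q ^ m) ^ y\<close> raises the exponent \<open>h - 1\<close>
    to \<open>h\<close>, and the factor \<open>q powi (h * a)\<close> of \<open>K\<close> completes
    it to \<open>q powi (h * (a + m * y))\<close>.\<close>
  have f: "K * (f (of_nat y) * (q ^ m) ^ y) = q_integrand h n \<xi> q (b + m * y) / qcount q m" for y
  proof -
    let ?C = "qcount q m" and ?X = "qcount q (b + m * y)"
    let ?A = "q powi (int m * (h - 1) * int y)" and ?B = "q powi (int m * int y)"
    have "qpow q (of_nat m * of_int (h - 1) * of_nat y) = ?A"
      by (subst qpow_of_int[OF q, symmetric]) simp
    moreover have "rootpow (\<xi> ^ m) (of_nat y) = \<xi> ^ (m * y)"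
      by (simp add: rootpow_of_nat Tp_power \<xi> power_mult)
    moreover have "qquot q (of_int a + of_nat m * of_nat y) m = ?X / ?C"
      by (subst qquot_of_nat[OF q, symmetric]) (simp add: b)
    ultimately have f: "f (of_nat y) = ?A * \<xi> ^ (m * y) * (?X / ?C) ^ n"
      by (simp only: f_def)
    have B: "(q ^ m) ^ y = ?B"
      by (simp only: power_mult[symmetric] of_nat_mult[symmetric] power_int_of_nat)
    have "K * (f (of_nat y) * (q ^ m) ^ y)
        = (?C ^ (n - 1) / ?C ^ n) * (q powi (h * a) * (?A * ?B)) * (\<xi> ^ b * \<xi> ^ (m * y)) * ?X ^ n"
      unfolding f B K_def power_divide by simp
    \<comment> \<open>As \<open>n > 0\<close>, the exponents differ by exactly 1; the remaining
      \<open>1 / [m; q]\<close> later joins \<open>1 / [p ^ M; q ^ m]\<close>.\<close>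
    also have "?C ^ (n - 1) / ?C ^ n = 1 / ?C"
      using n qcount_nonzero[OF q m] by (cases n) auto
    also have "q powi (h * a) * (?A * ?B) = q powi (h * int (b + m * y))"
      using q_nonzero[OF q] by (simp add: b power_int_add[symmetric] algebra_simps)
    finally show ?thesis
      by (simp add: q_integrand_def power_add)
  qed
  have s_eq: "s M = K * t M" for M
  proof -
    have "K * t M = 1 / qcount (q ^ m) (p ^ M) * (\<Sum>y<p ^ M. K * (f (of_nat y) * (q ^ m) ^ y))"
      unfolding t_def qnum_of_nat[OF absv_q_power_minus_1[OF q]] by (simp add: sum_distrib_left mult_ac)
    also have "\<dots> = s M"
      by (simp add: f s_def qcount_mult sum_divide_distrib[symmetric] mult.commute)
    finally show ?thesis
      by simp
  qed
  obtain c where c: "s \<longlonglongrightarrow> c"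
    using convergent_q_integrand[OF q \<xi> m] unfolding s_def convergent_def by blast
  have "(\<lambda>M. s M / K) \<longlonglongrightarrow> c / K"
    using K by (intro tendsto_divide_nonarch c tendsto_const)
  then have "t \<longlonglongrightarrow> c / K"
    using K by (simp add: s_eq)
  then have "lim t = c / K"
    by (rule limI)
  moreover have "q_bernoulli p h n (\<xi> ^ m) a m q = lim t"
    by (simp add: q_bernoulli_def q_integral_def t_def f_def)
  moreover have "qnum (of_nat m) q ^ (n - 1) * qpow q (of_int (h * a)) * \<xi> powi a = K"
    unfolding K_def qnum_of_nat[OF q] qpow_of_int[OF q] by (simp add: b)
  ultimately have "qnum (of_nat m) q ^ (n - 1) * qpow q (of_int (h * a)) * \<xi> powi a
      * q_bernoulli p h n (\<xi> ^ m) a m q = c"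
    using K by simp
  moreover have "(\<lambda>M. partial_measure l p q (q_integrand h n \<xi> q) M (Xball l p a N)) \<longlonglongrightarrow> c"
  proof (rule LIMSEQ_offset[where k = N])
    show "(\<lambda>M. partial_measure l p q (q_integrand h n \<xi> q) (M + N) (Xball l p a N)) \<longlonglongrightarrow> c"
      using c b unfolding s_def m_def by (simp add: partial_measure_Xball[OF l p_pos])
  qed
  ultimately show ?thesis
    by (simp add: m_def)
qed

lemma convergent_partial_measure:
  fixes q \<xi> :: 'a
  assumes q: "absv (q - 1) < rad" and \<xi>: "\<xi> \<in> Tp p" and l: "l > 0" and n: "n > 0"
    and U: "U \<in> compact_opens (XX l p)"
  shows "convergent (\<lambda>M. partial_measure l p q (q_integrand h n \<xi> q) M U)"
proof -
  obtain N A where A: "A \<subseteq> {0..<int (l * p ^ N)}" and U_eq: "U = \<Union>((\<lambda>a. Xball l p a N) ` A)"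
    using compact_open_decomposition[OF l p_pos U] .
  have "partial_measure l p q (q_integrand h n \<xi> q) M U
      = (\<Sum>B\<in>(\<lambda>a. Xball l p a N) ` A. partial_measure l p q (q_integrand h n \<xi> q) M B)" for M
    unfolding U_eq using finite_subset[OF A] disjoint_Xballs[OF l p_pos A]
    by (intro partial_measure_Union) auto
  moreover have "convergent (\<lambda>M. partial_measure l p q (q_integrand h n \<xi> q) M B)"
    if "B \<in> (\<lambda>a. Xball l p a N) ` A" for B
    using that A partial_measure_Xball_tendsto[OF q \<xi> l n] by (blast intro: convergentI)
  ultimately show ?thesis
    by (simp only:) (rule convergent_sum_nonarch)
qed

end

theorem theorem3:
  fixes p l n :: nat and h :: int and \<xi> q :: "'a::complete_nonarch_field"
  assumes "prime p" and "is_Cp p TYPE('a)"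
    and "l > 0" and "n > 0"
    and "\<xi> \<in> Tp p"
    and "absv (q - 1) < real p powr (- 1 / (real p - 1))"
  shows "\<exists>!\<nu>. \<nu> \<in> distributions (XX l p) \<and>
           (\<forall>N>0. \<forall>a\<in>{0..<int (l * p ^ N)}.
              \<nu> (Xball l p a N) =
                qnum (of_nat (l * p ^ N)) q ^ (n - 1) * qpow q (of_int (h * a)) * \<xi> powi a *
                q_bernoulli p h n (\<xi> ^ (l * p ^ N)) a (l * p ^ N) q)"
proof -
  interpret padic_absv p "TYPE('a)"
    using assms(1,2) by unfold_locales (auto simp: is_Cp_def)
  have q: "absv (q - 1) < rad"
    using assms(6) by (simp add: rad_def)
  let ?c = "partial_measure l p q (q_integrand h n \<xi> q)"
  \<comment> \<open>The restriction supplies the dummy value that \<open>distributions\<close>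
    demands outside the compact open sets.\<close>
  define \<nu> where "\<nu> = restrict (\<lambda>U. lim (\<lambda>M. ?c M U)) (compact_opens (XX l p))"
  have lim: "(\<lambda>M. ?c M U) \<longlonglongrightarrow> \<nu> U" if "U \<in> compact_opens (XX l p)" for U
    using convergent_partial_measure[OF q assms(5,3,4) that] that
    by (simp add: \<nu>_def convergent_LIMSEQ_iff)
  have "\<nu> (\<Union>\<U>) = (\<Sum>U\<in>\<U>. \<nu> U)" if \<U>: "finite \<U>" "\<U> \<subseteq> compact_opens (XX l p)" "disjoint \<U>" for \<U>
  proof (rule LIMSEQ_unique)
    have "\<Union>\<U> \<in> compact_opens (XX l p)"
      using \<U> by (auto simp: compact_opens_def intro!: compact_Union openin_Union)
    then show "(\<lambda>M. ?c M (\<Union>\<U>)) \<longlonglongrightarrow> \<nu> (\<Union>\<U>)"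
      by (rule lim)
    show "(\<lambda>M. ?c M (\<Union>\<U>)) \<longlonglongrightarrow> (\<Sum>U\<in>\<U>. \<nu> U)"
      unfolding partial_measure_Union[OF \<U>(1,3)] using \<U>(2) by (intro tendsto_sum lim) auto
  qed
  then have "\<nu> \<in> distributions (XX l p)"
    by (auto simp: distributions_def \<nu>_def)
  moreover have ball: "\<nu> (Xball l p a N) =
      qnum (of_nat (l * p ^ N)) q ^ (n - 1) * qpow q (of_int (h * a)) * \<xi> powi a *
      q_bernoulli p h n (\<xi> ^ (l * p ^ N)) a (l * p ^ N) q"
    if "a \<in> {0..<int (l * p ^ N)}" for a N
    using partial_measure_Xball_tendsto[OF q assms(5,3,4) that]
      lim[OF Xball_compact_open[OF assms(3) p_pos that]]
    by (rule LIMSEQ_unique[rotated])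
  ultimately show ?thesis
  proof (intro ex1I[of _ \<nu>] conjI allI impI ballI)
    fix \<nu>'
    assume \<nu>': "\<nu>' \<in> distributions (XX l p) \<and>
      (\<forall>N>0. \<forall>a\<in>{0..<int (l * p ^ N)}.
         \<nu>' (Xball l p a N) =
           qnum (of_nat (l * p ^ N)) q ^ (n - 1) * qpow q (of_int (h * a)) * \<xi> powi a *
           q_bernoulli p h n (\<xi> ^ (l * p ^ N)) a (l * p ^ N) q)"
    show "\<nu>' = \<nu>"
    proof (rule distributions_eqI[OF assms(3) p_pos])
      show "\<nu>' \<in> distributions (XX l p)" "\<nu> \<in> distributions (XX l p)"
        using \<nu>' \<open>\<nu> \<in> distributions (XX l p)\<close> by blast+
      show "\<nu>' (Xball l p a N) = \<nu> (Xball l p a N)"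
        if "N > 0" "a \<in> {0..<int (l * p ^ N)}" for N a
        using \<nu>' that ball[OF that(2)] by metis
    qed
  qed
qed

end
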